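(* Let $G_m$ be a bounded Vilenkin group. The maximal operator of Riesz logarithmic means $R^{\ast}f:=\sup_{n\in\mathbf{P}_+}|R_nf|$ is bounded from the martingale Hardy space $H_{1/2}(G_m)$ to the space $L_{1/2,\infty}(G_m)$; that is, there is a constant $c$ (depending only on $m$) such that $\|R^{\ast}f\|_{L_{1/2,\infty}}\le c\,\|f\|_{H_{1/2}}$ for every martingale $f\in H_{1/2}(G_m)$.
   Context: $\mathbf{P}_+$ is the set of positive integers and $\mathbf{P}:=\mathbf{P}_+\cup\{0\}$. Let $m=(m_0,m_1,\dots)$ be a sequence of integers $\ge 2$ with $\sup_n m_n<\infty$. $Z_{m_k}=\{0,1,\dots,m_k-1\}$ is the additive group of integers modulo $m_k$ (discrete topology), and $G_m:=\prod_{k\ge 0}Z_{m_k}$ is the complete direct product with the product topology, called a bounded Vilenkin group because $\sup_n m_n<\infty$. $\mu$ is the product of the uniform probability measures on the $Z_{m_k}$, i.e. the normalized Haar measure on $G_m$. Elements are $x=(x_0,x_1,\dots)$ with $x_k\in Z_{m_k}$. Put $I_0(x):=G_m$ and $I_n(x):=\{y\in G_m: y_0=x_0,\dots,y_{n-1}=x_{n-1}\}$. Generalized number system: $M_0:=1$, $M_{k+1}:=m_kM_k$; every $n\in\mathbf{P}$ is uniquely $n=\sum_{j\ge0}n_jM_j$ with $n_j\in Z_{m_j}$, only finitely many nonzero. Generalized Rademacher functions: $r_k(x):=\exp(2\pi i x_k/m_k)$. Vilenkin system: $\psi_n(x):=\prod_{k\ge0}r_k^{n_k}(x)$, $n\in\mathbf{P}$.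 $\mathcal F_n$ is the $\sigma$-algebra generated by $\{I_n(x):x\in G_m\}$. Martingales $f=(f^{(n)},n\in\mathbf{P})$ are with respect to $(\mathcal F_n)$. The maximal function is $f^{\ast}:=\sup_{n\in\mathbf{P}}|f^{(n)}|$, and for $0<p<\infty$ the Hardy space $H_p(G_m)$ consists of all martingales with $\|f\|_{H_p}:=\|f^{\ast}\|_p<\infty$, where $\|g\|_p:=\left(\int_{G_m}|g|^pd\mu\right)^{1/p}$. The weak space $L_{p,\infty}(G_m)$ consists of measurable $g$ with $\|g\|_{L_{p,\infty}}:=\sup_{\lambda>0}\lambda\,\mu(|g|>\lambda)^{1/p}<\infty$. For a martingale $f$: the Vilenkin–Fourier coefficients are $\widehat f(i):=\lim_{k\to\infty}\int_{G_m}f^{(k)}\overline{\psi_i}\,d\mu$; the partial sums are $S_nf:=\sum_{k=0}^{n-1}\widehat f(k)\psi_k$; the $n$-th Riesz logarithmic mean is $R_nf:=\frac1{l_n}\sum_{k=1}^n\frac{S_kf}{k}$ with $l_n:=\sum_{k=1}^n\frac1k$, for $n\in\mathbf{P}_+$. *)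

theory Defs
  imports "HOL-Probability.Probability"
begin

text \<open>
  The group \<open>G\<^sub>m\<close> is \<open>space (vilenkin m)\<close>, i.e. the set of all \<open>x :: nat \<Rightarrow> nat\<close> with
  \<open>x k < m k\<close> for all \<open>k\<close>. Each factor carries the discrete topology and is finite, so the
  product \<open>\<sigma>\<close>-algebra is the Borel \<open>\<sigma>\<close>-algebra of the product topology.
\<close>

definition vilenkin :: "(nat \<Rightarrow> nat) \<Rightarrow> (nat \<Rightarrow> nat) measure" where
  "vilenkin m = (\<Pi>\<^sub>M k\<in>UNIV. uniform_count_measure {..<m k})"

definition vinterval :: "(nat \<Rightarrow> nat) \<Rightarrow> nat \<Rightarrow> (nat \<Rightarrow> nat) \<Rightarrow> (nat \<Rightarrow> nat) set" where
  "vinterval m n x = {y \<in> space (vilenkin m). \<forall>k<n. y k = x k}"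

definition vfilt :: "(nat \<Rightarrow> nat) \<Rightarrow> nat \<Rightarrow> (nat \<Rightarrow> nat) measure" where
  "vfilt m n = sigma (space (vilenkin m)) (vinterval m n ` space (vilenkin m))"

primrec vbase :: "(nat \<Rightarrow> nat) \<Rightarrow> nat \<Rightarrow> nat" where
  "vbase m 0 = 1"
| "vbase m (Suc k) = m k * vbase m k"

text \<open>
  Closed form of the \<open>j\<close>-th digit of \<open>n\<close>; the lemmas \<open>vdigit_expansion\<close> and \<open>vdigit_unique\<close>
  below show that these are exactly the digits of the expansion \<open>n = (\<Sum>j. n\<^sub>j * M\<^sub>j)\<close>.
\<close>

definition vdigit :: "(nat \<Rightarrow> nat) \<Rightarrow> nat \<Rightarrow> nat \<Rightarrow> nat" where
  "vdigit m n j = n div vbase m j mod m j"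

lemma vbase_gt:
  assumes "\<And>k. m k \<ge> 2"
  shows "n < vbase m n"
proof (induction n)
  case (Suc n)
  have "Suc n < 2 * vbase m n" using Suc by simp
  also have "\<dots> \<le> m n * vbase m n" using assms by (intro mult_right_mono) auto
  finally show ?case by simp
qed simp

lemma vdigit_nonzero_subset:
  assumes "\<And>k. m k \<ge> 2"
  shows "{j. vdigit m n j \<noteq> 0} \<subseteq> {..<n}"
proof
  fix j assume j: "j \<in> {j. vdigit m n j \<noteq> 0}"
  have "vbase m j \<le> n"
  proof (rule ccontr)
    assume "\<not> vbase m j \<le> n"
    then have "n div vbase m j = 0" by simp
    with j show False by (simp add: vdigit_def)
  qed
  moreover have "j < vbase m j" using assms by (rule vbase_gt)
  ultimately show "j \<in> {..<n}" by simp
qed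

lemma finite_vdigit:
  assumes "\<And>k. m k \<ge> 2"
  shows "finite {j. vdigit m n j \<noteq> 0}"
  using vdigit_nonzero_subset[of m n] assms finite_subset by blast

lemma vdigit_partial:
  "(\<Sum>j<N. vdigit m n j * vbase m j) = n mod vbase m N"
proof (induction N)
  case (Suc N)
  have "n mod (vbase m N * m N) = vbase m N * (n div vbase m N mod m N) + n mod vbase m N"
    by (rule mod_mult2_eq)
  with Suc show ?case by (simp add: vdigit_def mult.commute)
qed simp

lemma vdigit_expansion:
  assumes "\<And>k. m k \<ge> 2"
  shows "(\<Sum>j | vdigit m n j \<noteq> 0. vdigit m n j * vbase m j) = n"
proof -
  have "{j. vdigit m n j \<noteq> 0} \<subseteq> {..<n}"
    using assms by (rule vdigit_nonzero_subset)
  then have "(\<Sum>j | vdigit m n j \<noteq> 0. vdigit m n j * vbase m j) = (\<Sum>j<n. vdigit m n j * vbase m j)"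
    by (intro sum.mono_neutral_left) auto
  also have "\<dots> = n"
    using vbase_gt[of m n] assms by (simp add: vdigit_partial)
  finally show ?thesis .
qed

lemma vdigit_unique:
  assumes m: "\<And>k. m k \<ge> 2" and d: "\<And>j. d j < m j"
    and fin: "finite {j. d j \<noteq> 0}" and n: "n = (\<Sum>j | d j \<noteq> 0. d j * vbase m j)"
  shows "d = vdigit m n"
proof
  fix j
  define e where "e N = (\<Sum>j<N. d j * vbase m j)" for N
  have e_less: "e N < vbase m N" for N
  proof (induction N)
    case (Suc N)
    have "e (Suc N) < vbase m N + d N * vbase m N" using Suc by (simp add: e_def)
    also have "\<dots> = Suc (d N) * vbase m N" by simp
    also have "\<dots> \<le> m N * vbase m N" using d[of N] by (intro mult_right_mono) auto
    finally show ?case by simp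
  qed (simp add: e_def)
  have e_mod: "e (N + k) mod vbase m N = e N" for N k
  proof (induction k)
    case 0
    then show ?case using e_less by simp
  next
    case (Suc k)
    have "vbase m N dvd vbase m (N + k)" by (induction k) auto
    then have "d (N + k) * vbase m (N + k) mod vbase m N = 0" by simp
    then have "(e (N + k) + d (N + k) * vbase m (N + k)) mod vbase m N = e (N + k) mod vbase m N"
      by (metis add.right_neutral mod_add_right_eq)
    then show ?case using Suc by (simp add: e_def)
  qed
  obtain B where B: "{j. d j \<noteq> 0} \<subseteq> {..<B}"
    using fin by (meson finite_nat_iff_bounded)
  define K where "K = Suc j + B"
  have "n = e K"
    unfolding n e_def using B by (intro sum.mono_neutral_left) (auto simp: K_def)
  then have eq: "n mod vbase m (Suc j) = e (Suc j)" "n mod vbase m j = e j"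
    using e_mod[of "Suc j" B] e_mod[of j "Suc B"] by (auto simp: K_def)
  have "vdigit m n j * vbase m j + e j = d j * vbase m j + e j"
    using eq vdigit_partial[of m n j] vdigit_partial[of m n "Suc j"] by (simp add: e_def)
  then show "d j = vdigit m n j"
    using vbase_gt[of m j] m by (auto simp: less_eq_Suc_le)
qed

definition rademacher :: "(nat \<Rightarrow> nat) \<Rightarrow> nat \<Rightarrow> (nat \<Rightarrow> nat) \<Rightarrow> complex" where
  "rademacher m k x = exp (2 * of_real pi * \<i> * of_nat (x k) / of_nat (m k))"

text \<open>
  All factors with \<open>vdigit m n k = 0\<close> equal \<open>1\<close>, and the remaining index set is finite
  by \<open>finite_vdigit\<close>.
\<close>

definition vpsi :: "(nat \<Rightarrow> nat) \<Rightarrow> nat \<Rightarrow> (nat \<Rightarrow> nat) \<Rightarrow> complex" where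
  "vpsi m n x = (\<Prod>k | vdigit m n k \<noteq> 0. rademacher m k x ^ vdigit m n k)"

definition complex_cond_exp :: "'a measure \<Rightarrow> 'a measure \<Rightarrow> ('a \<Rightarrow> complex) \<Rightarrow> 'a \<Rightarrow> complex" where
  "complex_cond_exp M F f x =
     Complex (real_cond_exp M F (\<lambda>y. Re (f y)) x) (real_cond_exp M F (\<lambda>y. Im (f y)) x)"

definition vmartingale :: "(nat \<Rightarrow> nat) \<Rightarrow> (nat \<Rightarrow> (nat \<Rightarrow> nat) \<Rightarrow> complex) \<Rightarrow> bool" where
  "vmartingale m f \<longleftrightarrow>
     (\<forall>n. f n \<in> borel_measurable (vfilt m n)) \<and>
     (\<forall>n. integrable (vilenkin m) (f n)) \<and>
     (\<forall>n k. n \<le> k \<longrightarrow>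
        (AE x in vilenkin m. complex_cond_exp (vilenkin m) (vfilt m n) (f k) x = f n x))"

definition maximal_function :: "(nat \<Rightarrow> 'a \<Rightarrow> complex) \<Rightarrow> 'a \<Rightarrow> ennreal" where
  "maximal_function f x = (SUP n. ennreal (norm (f n x)))"

text \<open>Powers \<open>x\<^sup>a\<close> on \<open>[0, \<infinity>]\<close>; only used for \<open>a > 0\<close>.\<close>

definition ennreal_powr :: "ennreal \<Rightarrow> real \<Rightarrow> ennreal" where
  "ennreal_powr x a = (if x = \<top> then \<top> else ennreal (enn2real x powr a))"

text \<open>
  The functions \<open>g\<close> below are already absolute values or suprema of absolute values, possibly
  taking the value \<open>\<infinity>\<close>.
\<close>

definition Lp_norm :: "'a measure \<Rightarrow> real \<Rightarrow> ('a \<Rightarrow> ennreal) \<Rightarrow> ennreal" where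
  "Lp_norm M p g = ennreal_powr (\<integral>\<^sup>+x. ennreal_powr (g x) p \<partial>M) (1 / p)"

definition weak_Lp_norm :: "'a measure \<Rightarrow> real \<Rightarrow> ('a \<Rightarrow> ennreal) \<Rightarrow> ennreal" where
  "weak_Lp_norm M p g =
     (SUP t\<in>{0::real<..}. ennreal t * ennreal_powr (emeasure M {x \<in> space M. g x > ennreal t}) (1 / p))"

definition weak_Lp :: "'a measure \<Rightarrow> real \<Rightarrow> ('a \<Rightarrow> ennreal) set" where
  "weak_Lp M p = {g \<in> borel_measurable M. weak_Lp_norm M p g < \<infinity>}"

definition Hp_norm :: "(nat \<Rightarrow> nat) \<Rightarrow> real \<Rightarrow> (nat \<Rightarrow> (nat \<Rightarrow> nat) \<Rightarrow> complex) \<Rightarrow> ennreal" where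
  "Hp_norm m p f = Lp_norm (vilenkin m) p (maximal_function f)"

definition Hp :: "(nat \<Rightarrow> nat) \<Rightarrow> real \<Rightarrow> (nat \<Rightarrow> (nat \<Rightarrow> nat) \<Rightarrow> complex) set" where
  "Hp m p = {f. vmartingale m f \<and> Hp_norm m p f < \<infinity>}"

definition vcoeff :: "(nat \<Rightarrow> nat) \<Rightarrow> (nat \<Rightarrow> (nat \<Rightarrow> nat) \<Rightarrow> complex) \<Rightarrow> nat \<Rightarrow> complex" where
  "vcoeff m f i = lim (\<lambda>k. \<integral>x. f k x * cnj (vpsi m i x) \<partial>vilenkin m)"

definition vpartial_sum ::
    "(nat \<Rightarrow> nat) \<Rightarrow> (nat \<Rightarrow> (nat \<Rightarrow> nat) \<Rightarrow> complex) \<Rightarrow> nat \<Rightarrow> (nat \<Rightarrow> nat) \<Rightarrow> complex" where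
  "vpartial_sum m f n x = (\<Sum>k<n. vcoeff m f k * vpsi m k x)"

definition riesz_mean ::
    "(nat \<Rightarrow> nat) \<Rightarrow> (nat \<Rightarrow> (nat \<Rightarrow> nat) \<Rightarrow> complex) \<Rightarrow> nat \<Rightarrow> (nat \<Rightarrow> nat) \<Rightarrow> complex" where
  "riesz_mean m f n x = (1 / harm n) * (\<Sum>k=1..n. vpartial_sum m f k x / of_nat k)"

definition riesz_maximal ::
    "(nat \<Rightarrow> nat) \<Rightarrow> (nat \<Rightarrow> (nat \<Rightarrow> nat) \<Rightarrow> complex) \<Rightarrow> (nat \<Rightarrow> nat) \<Rightarrow> ennreal" where
  "riesz_maximal m f x = (SUP n\<in>{1..}. ennreal (norm (riesz_mean m f n x)))"

end

theory Submission
  imports Defs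
begin

text \<open>
  By Abel summation \<open>R\<^sub>n f\<close> is a convex combination of Fejer means, so it suffices to bound the
  maximal operator of the Fejer means. Write \<open>M\<^sub>A\<close> for \<open>vbase m A\<close>. Up to a constant, the \<open>n\<close>-th Fejer
  kernel (times \<open>n\<close>) is at most the sum, over \<open>M\<^sub>A \<le> n\<close> and \<open>t \<le> A\<close>, of \<open>M\<^sub>A M\<^sub>t\<close> times the indicator
  of the pairs whose first \<open>A\<close> coordinates agree except possibly in position \<open>t\<close>. Hence the
  Fejer means are bounded on \<open>L\<^sub>\<infinity>\<close>, and the means of a function \<open>a\<close> with integral \<open>0\<close> supported on
  an interval \<open>I\<close> of rank \<open>N\<close> are dominated off \<open>I\<close>, uniformly in \<open>n\<close>, by \<open>\<parallel>a\<parallel>\<^sub>\<infinity> / M\<^sub>N\<^sup>2\<close> times the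
  part of this sum with \<open>A \<le> N\<close>, which is of weak type \<open>1/2\<close>.

  Only \<open>f L\<close> matters for the means with \<open>n \<le> M\<^sub>L\<close>. Stopping the martingale when it is about to exceed
  \<open>4\<^sup>k \<alpha>\<close>, where \<open>\<alpha>\<close> is a small multiple of the level of the distribution
  function, writes \<open>f L\<close> as a function bounded by \<open>\<alpha>\<close> plus atoms. The bounded part never
  reaches the level, and the atoms contribute at most a constant times \<open>\<Sum>\<^sub>k 2\<^sup>k \<mu>(f\<^sup>* > 4\<^sup>k \<alpha>)\<close>, which is of order \<open>\<alpha>\<^sup>-\<^sup>1\<^sup>/\<^sup>2 \<integral> (f\<^sup>*)\<^sup>1\<^sup>/\<^sup>2\<close>.
\<close>

section \<open>Cylinders and cylindrical functions\<close>

locale bounded_vilenkin =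
  fixes m :: "nat \<Rightarrow> nat" and B :: real
  assumes m_ge_2: "m k \<ge> 2" and m_le_B: "real (m k) \<le> B"
begin

abbreviation "G \<equiv> space (vilenkin m)"
abbreviation "M k \<equiv> real (vbase m k)"

lemma B_ge_2: "B \<ge> 2"
  using m_ge_2[of 0] m_le_B[of 0] by linarith

lemma m_pos: "m k > 0"
  using m_ge_2[of k] by linarith

section \<open>Haar measure of cylinders\<close>

lemma prod_space: "product_prob_space (\<lambda>k. uniform_count_measure {..<m k})"
  unfolding product_prob_space_def product_sigma_finite_def product_prob_space_axioms_def
proof (intro conjI allI)
  fix i
  show "prob_space (uniform_count_measure {..<m i})"
    using m_ge_2[of i] by (intro prob_space_uniform_count_measure) (auto simp: lessThan_empty_iff)
  then show "sigma_finite_measure (uniform_count_measure {..<m i})"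
    by (rule prob_space_imp_sigma_finite)
qed

lemma prob_space_vilenkin: "prob_space (vilenkin m)"
proof -
  interpret product_prob_space "\<lambda>k. uniform_count_measure {..<m k}" UNIV by (rule prod_space)
  show ?thesis unfolding vilenkin_def by (rule P.prob_space_axioms)
qed

sublocale prob_space "vilenkin m" by (rule prob_space_vilenkin)

lemma G_iff: "x \<in> G \<longleftrightarrow> (\<forall>k. x k < m k)"
  by (auto simp: vilenkin_def space_PiM PiE_iff space_uniform_count_measure)

text \<open>The positions form an arbitrary finite set, not an initial segment, because
  \<open>agree t A\<close> skips position \<open>t\<close>.\<close>

lemma emeasure_cylinder:
  assumes "finite J" "x \<in> G"
  shows "emeasure (vilenkin m) {y \<in> G. \<forall>j\<in>J. y j = x j} = ennreal (\<Prod>j\<in>J. 1 / real (m j))"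
proof -
  interpret product_prob_space "\<lambda>k. uniform_count_measure {..<m k}" UNIV by (rule prod_space)
  have "emeasure (vilenkin m) {y \<in> G. \<forall>j\<in>J. y j \<in> {x j}} =
    (\<Prod>j\<in>J. emeasure (uniform_count_measure {..<m j}) {x j})"
    unfolding vilenkin_def using assms
    by (intro emeasure_PiM_Collect) (auto simp: sets_uniform_count_measure G_iff)
  also have "\<dots> = (\<Prod>j\<in>J. ennreal (1 / real (m j)))"
    using assms by (intro prod.cong) (auto simp: emeasure_uniform_count_measure G_iff)
  finally show ?thesis by (simp add: prod_ennreal)
qed

lemma sets_cylinder:
  assumes "finite J"
  shows "{y \<in> G. \<forall>j\<in>J. y j = x j} \<in> sets (vilenkin m)"
proof -
  \<comment> \<open>\<open>x\<close> is arbitrary here, so \<open>x j\<close> may lie outside its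
    factor; intersecting with the factor yields a measurable set and leaves the cylinder
    unchanged.\<close>
  have "{y \<in> G. \<forall>j\<in>J. y j = x j} = {y \<in> G. \<forall>j\<in>J. y j \<in> {x j} \<inter> {..<m j}}"
    by (auto simp: G_iff)
  also have "\<dots> \<in> sets (vilenkin m)"
  proof -
    have *: "(\<lambda>y. y j) \<in> measurable (vilenkin m) (uniform_count_measure {..<m j})" for j
      unfolding vilenkin_def by (rule measurable_component_singleton) simp
    have "{y \<in> G. y j \<in> {x j} \<inter> {..<m j}} \<in> sets (vilenkin m)" for j
      using measurable_sets[OF *, of "{x j} \<inter> {..<m j}" j]
      by (auto simp: sets_uniform_count_measure vimage_def Int_def conj_commute)
    then show ?thesis using assms by (intro sets.sets_Collect_finite_All) auto
  qed
  finally show ?thesis .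
qed

lemma M_eq_prod: "M n = (\<Prod>j<n. real (m j))"
  by (induction n) (auto simp: mult.commute)

lemma M_pos: "M n > 0"
  using m_pos by (auto simp: M_eq_prod intro!: prod_pos)

lemma M_Suc_ge: "2 * M n \<le> M (Suc n)"
  using m_ge_2[of n] M_pos[of n] by simp

lemma M_Suc_le: "M (Suc n) \<le> B * M n"
  using m_le_B[of n] M_pos[of n] by simp

lemma M_mono: "i \<le> j \<Longrightarrow> M i \<le> M j"
proof (rule lift_Suc_mono_le[of M])
  show "M n \<le> M (Suc n)" for n
    using M_Suc_ge[of n] M_pos[of n] by linarith
qed

lemma vbase_mono: "i \<le> j \<Longrightarrow> vbase m i \<le> vbase m j"
  using M_mono[of i j] by simp

lemma less_vbase: "n < vbase m n"
  using m_ge_2 by (rule vbase_gt)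

text \<open>\<open>agree t A x y\<close> allows \<open>x\<close> and \<open>y\<close> to differ in position \<open>t\<close>; for \<open>t \<ge> A\<close> it is plain
  agreement of the first \<open>A\<close> coordinates.\<close>

definition agree :: "nat \<Rightarrow> nat \<Rightarrow> (nat \<Rightarrow> nat) \<Rightarrow> (nat \<Rightarrow> nat) \<Rightarrow> bool" where
  "agree t A x y \<longleftrightarrow> (\<forall>j<A. j \<noteq> t \<longrightarrow> x j = y j)"

lemma agree_cylinder: "{y\<in>G. agree t A x y} = {y \<in> G. \<forall>j\<in>{..<A} - {t}. y j = x j}"
  by (auto simp: agree_def)

lemma sets_agree [measurable]: "{y\<in>G. agree t A x y} \<in> sets (vilenkin m)"
  unfolding agree_cylinder by (rule sets_cylinder) simp

lemma vinterval_agree: "vinterval m n x = {y\<in>G. agree n n x y}"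
  by (auto simp: vinterval_def agree_def)

lemma sets_vinterval [measurable]: "vinterval m n x \<in> sets (vilenkin m)"
  unfolding vinterval_agree by simp

lemma prob_vinterval:
  assumes "x \<in> G"
  shows "prob (vinterval m n x) = 1 / M n"
proof -
  have "emeasure (vilenkin m) (vinterval m n x) = ennreal (\<Prod>j<n. 1 / real (m j))"
    using emeasure_cylinder[OF finite_lessThan assms, of n] by (simp only: vinterval_def lessThan_iff Ball_def)
  then show ?thesis by (simp add: measure_def M_eq_prod prod_dividef prod_nonneg)
qed

text \<open>Freeing one position \<open>t\<close> below \<open>A\<close> multiplies the measure
  \<open>1 / M A\<close> by \<open>m t\<close>, which is at most \<open>B\<close>.\<close>

lemma prob_agree_le:
  assumes "x \<in> G"
  shows "prob {y\<in>G. agree t A x y} \<le> B / M A"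
proof -
  have *: "prob {y\<in>G. agree t A x y} = (\<Prod>j\<in>{..<A} - {t}. 1 / real (m j))"
    using emeasure_cylinder[OF _ assms, of "{..<A}-{t}"] 
    by (simp add: agree_cylinder measure_def prod_nonneg)
  show ?thesis
  proof (cases "t < A")
    case True
    then have "M A = real (m t) * (\<Prod>j\<in>{..<A} - {t}. real (m j))"
      unfolding M_eq_prod by (subst prod.remove[of _ t]) auto
    then show ?thesis using M_pos[of A] m_le_B[of t] m_ge_2[of t]
      unfolding * by (simp add: prod_dividef divide_simps)
  next
    case False
    then have "{..<A} - {t} = {..<A}" by auto
    then show ?thesis using B_ge_2 M_pos[of A] unfolding * by (simp add: M_eq_prod prod_dividef divide_simps prod_pos)
  qed
qed

section \<open>Interval representatives and functions of finitely many coordinates\<close>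

definition reps :: "nat \<Rightarrow> (nat \<Rightarrow> nat) set" where
  "reps n = {z \<in> G. \<forall>j\<ge>n. z j = 0}"

definition rep :: "nat \<Rightarrow> (nat \<Rightarrow> nat) \<Rightarrow> nat \<Rightarrow> nat" where
  "rep n x = (\<lambda>j. if j < n then x j else 0)"

lemma finite_reps: "finite (reps n)"
proof (rule finite_subset)
  show "reps n \<subseteq> (\<lambda>f j. if j < n then f j else 0) ` (PiE {..<n} (\<lambda>j. {..<m j}))"
  proof
    fix z assume "z \<in> reps n"
    then have "z = (\<lambda>j. if j < n then restrict z {..<n} j else 0)" "restrict z {..<n} \<in> PiE {..<n} (\<lambda>j. {..<m j})"
      by (auto simp: reps_def G_iff)
    then show "z \<in> (\<lambda>f j. if j < n then f j else 0) ` (PiE {..<n} (\<lambda>j. {..<m j}))"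
      by (rule image_eqI)
  qed
qed (auto intro!: finite_imageI finite_PiE)

lemma reps_in_G: "z \<in> reps n \<Longrightarrow> z \<in> G"
  by (simp add: reps_def)

lemma rep_in_reps: "x \<in> G \<Longrightarrow> rep n x \<in> reps n"
  using m_pos by (auto simp: rep_def reps_def G_iff)

lemma in_vinterval_rep: "z \<in> reps n \<Longrightarrow> x \<in> G \<Longrightarrow> x \<in> vinterval m n z \<longleftrightarrow> z = rep n x"
  unfolding vinterval_def reps_def rep_def
  by (simp add: fun_eq_iff) (metis not_less)

lemma rep_in_vinterval: "x \<in> G \<Longrightarrow> rep n x \<in> vinterval m n x"
  using m_pos by (auto simp: vinterval_def rep_def G_iff)

text \<open>A pointwise substitute for measurability with respect to \<open>vfilt m n\<close>. Such
  functions take finitely many values on \<open>G\<close>, so measurability, boundedness and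
  integrability come for free.\<close>

definition cylindrical :: "nat \<Rightarrow> ((nat \<Rightarrow> nat) \<Rightarrow> 'a) \<Rightarrow> bool" where
  "cylindrical n g \<longleftrightarrow> (\<forall>x\<in>G. \<forall>y\<in>G. (\<forall>j<n. x j = y j) \<longrightarrow> g x = g y)"

lemma cylindricalI:
  assumes "\<And>x y. x \<in> G \<Longrightarrow> y \<in> G \<Longrightarrow> (\<And>j. j < n \<Longrightarrow> x j = y j) \<Longrightarrow> g x = g y"
  shows "cylindrical n g"
  unfolding cylindrical_def by (intro ballI impI, rule assms) simp_all

lemma cylindrical_eq:
  assumes "cylindrical n g" "x \<in> G" "y \<in> G" "\<And>j. j < n \<Longrightarrow> x j = y j"
  shows "g x = g y"
  using assms(1)[unfolded cylindrical_def, rule_format, of x y] assms(2-4) by simp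

lemma cylindricalD: "cylindrical n g \<Longrightarrow> x \<in> G \<Longrightarrow> y \<in> vinterval m n x \<Longrightarrow> g y = g x"
  by (rule cylindrical_eq[of n]) (auto simp: vinterval_def)

lemma cylindrical_mono:
  assumes "cylindrical n g" "n \<le> k"
  shows "cylindrical k g"
  by (rule cylindricalI, rule cylindrical_eq[OF assms(1)]) (use assms(2) in simp_all)

lemma cylindrical_const: "cylindrical n (\<lambda>x. c)"
  by (simp add: cylindrical_def)

lemma cylindrical_comp:
  assumes "cylindrical n f"
  shows "cylindrical n (\<lambda>x. h (f x))"
  by (rule cylindricalI, rule arg_cong[where f=h], rule cylindrical_eq[OF assms])

lemma cylindrical_comp2:
  assumes "cylindrical n f" "cylindrical n g"
  shows "cylindrical n (\<lambda>x. h (f x) (g x))"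
  by (rule cylindricalI, rule arg_cong2[where f=h]; rule cylindrical_eq, rule assms)

lemma cylindrical_sum:
  assumes "\<And>i. i \<in> I \<Longrightarrow> cylindrical n (f i)"
  shows "cylindrical n (\<lambda>x. \<Sum>i\<in>I. f i x)"
  by (rule cylindricalI, rule sum.cong[OF refl], rule cylindrical_eq, rule assms)

lemma cylindrical_prod:
  assumes "\<And>i. i \<in> I \<Longrightarrow> cylindrical n (f i)"
  shows "cylindrical n (\<lambda>x. \<Prod>i\<in>I. f i x)"
  by (rule cylindricalI, rule prod.cong[OF refl], rule cylindrical_eq, rule assms)

lemma cylindrical_vinterval: "N \<le> n \<Longrightarrow> cylindrical n (\<lambda>x. x \<in> vinterval m N z)"
  by (auto simp: cylindrical_def vinterval_def)

lemma cylindrical_agree: "A \<le> n \<Longrightarrow> cylindrical n (\<lambda>x. agree t A z x)"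
  by (auto simp: cylindrical_def agree_def)

lemma cylindrical_rep: "cylindrical n g \<Longrightarrow> x \<in> G \<Longrightarrow> g (rep n x) = g x"
  by (rule cylindricalD) (auto intro: rep_in_vinterval)

lemma cylindrical_measurable:
  assumes "cylindrical n g"
  shows "g \<in> borel_measurable (vilenkin m)"
proof (rule measurableI)
  fix S
  have "g -` S \<inter> G = (\<Union>z\<in>{z\<in>reps n. g z \<in> S}. vinterval m n z)"
  proof (intro set_eqI iffI)
    fix x assume "x \<in> g -` S \<inter> G"
    then show "x \<in> (\<Union>z\<in>{z\<in>reps n. g z \<in> S}. vinterval m n z)"
      using cylindrical_rep[OF assms, of x] rep_in_reps[of x n] in_vinterval_rep[of "rep n x" n x] by auto
  next
    fix x assume "x \<in> (\<Union>z\<in>{z\<in>reps n. g z \<in> S}. vinterval m n z)"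
    then obtain z where z: "z \<in> reps n" "g z \<in> S" "x \<in> vinterval m n z" by blast
    then show "x \<in> g -` S \<inter> G"
      using cylindricalD[OF assms reps_in_G z(3)] by (auto simp: vinterval_def)
  qed
  also have "\<dots> \<in> sets (vilenkin m)"
    using finite_reps by (intro sets.finite_UN) auto
  finally show "g -` S \<inter> G \<in> sets (vilenkin m)" .
qed auto

lemma cylindrical_bounded:
  fixes g :: "(nat \<Rightarrow> nat) \<Rightarrow> 'a::real_normed_vector"
  assumes "cylindrical n g"
  obtains K where "\<And>x. x \<in> G \<Longrightarrow> norm (g x) \<le> K"
proof
  fix x assume "x \<in> G"
  then show "norm (g x) \<le> Max ((\<lambda>z. norm (g z)) ` reps n)"
    using finite_reps cylindrical_rep[OF assms, of x] rep_in_reps[of x n]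
    by (intro Max_ge image_eqI[where x="rep n x"]) auto
qed

lemma cylindrical_integrable:
  fixes g :: "(nat \<Rightarrow> nat) \<Rightarrow> 'a::{banach,second_countable_topology}"
  assumes "cylindrical n g"
  shows "integrable (vilenkin m) g"
proof -
  obtain K where "\<And>x. x \<in> G \<Longrightarrow> norm (g x) \<le> K" by (rule cylindrical_bounded[OF assms]) auto
  then show ?thesis
    by (intro integrable_const_bound[where B=K] cylindrical_measurable[OF assms] AE_I2)
qed

text \<open>The intervals of the representatives partition \<open>G\<close>, so exactly one summand
  survives.\<close>

lemma sum_reps:
  fixes c :: "(nat \<Rightarrow> nat) \<Rightarrow> 'a::comm_monoid_add"
  assumes "x \<in> G"
  shows "(\<Sum>z\<in>reps n. if x \<in> vinterval m n z then c z else 0) = c (rep n x)"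
proof -
  have "(\<Sum>z\<in>reps n. if x \<in> vinterval m n z then c z else 0) = (\<Sum>z\<in>reps n. if z = rep n x then c z else 0)"
    using in_vinterval_rep[of _ n x] assms by (intro sum.cong) auto
  then show ?thesis using rep_in_reps[OF assms] finite_reps by (simp add: sum.delta)
qed

section \<open>The filtration generated by intervals\<close>

lemma vfilt_set_invariant:
  assumes "S \<in> sets (vfilt m n)" "x \<in> G" "y \<in> vinterval m n x"
  shows "y \<in> S \<longleftrightarrow> x \<in> S"
proof -
  have "S \<in> sigma_sets G (vinterval m n ` G)"
    using assms(1) unfolding vfilt_def by (subst (asm) sets_measure_of) (auto simp: vinterval_def)
  then show ?thesis using assms(2,3)
  proof (induction rule: sigma_sets.induct)
    case (Basic a)
    then show ?case by (auto simp: vinterval_def)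
  next
    case (Compl a)
    then show ?case by (auto simp: vinterval_def)
  qed auto
qed

lemma space_vfilt: "space (vfilt m n) = G"
  unfolding vfilt_def by (rule space_measure_of) (auto simp: vinterval_def)

lemma vinterval_in_vfilt: "x \<in> G \<Longrightarrow> vinterval m n x \<in> sets (vfilt m n)"
  unfolding vfilt_def by (subst sets_measure_of) (auto simp: vinterval_def)

lemma subalgebra_vfilt: "subalgebra (vilenkin m) (vfilt m n)"
  unfolding subalgebra_def
proof (intro conjI)
  show "sets (vfilt m n) \<subseteq> sets (vilenkin m)"
    unfolding vfilt_def
    by (subst sets_measure_of) (auto simp: vinterval_def[abs_def] intro!: sets.sigma_sets_subset sets_vinterval[unfolded vinterval_def])
qed (simp add: space_vfilt)

text \<open>Sets of \<open>vfilt m n\<close> do not separate points of one rank \<open>n\<close>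
  interval, and level sets of \<open>g\<close> are such sets because points are closed. Hence
  martingale terms are constant on intervals everywhere, not just almost everywhere.\<close>

lemma vfilt_cylindrical:
  fixes g :: "(nat \<Rightarrow> nat) \<Rightarrow> 'a::t1_space"
  assumes "g \<in> borel_measurable (vfilt m n)"
  shows "cylindrical n g"
  unfolding cylindrical_def
proof (intro ballI impI)
  fix x y assume xy: "x \<in> G" "y \<in> G" "\<forall>j<n. x j = y j"
  have "g -` {g x} \<inter> space (vfilt m n) \<in> sets (vfilt m n)"
    using assms by (rule measurable_sets) simp
  from vfilt_set_invariant[OF this xy(1), of y] xy show "g x = g y"
    by (auto simp: vinterval_def space_vfilt)
qed

end

section \<open>The Fejer kernel\<close>

lemma sum_roots_of_unity:
  fixes z :: complex
  assumes "z ^ n = 1" "z \<noteq> 1"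
  shows "(\<Sum>s<n. z ^ s) = 0"
  using assms by (simp add: sum_gp_strict)

context bounded_vilenkin
begin

section \<open>Vilenkin functions and leading digits\<close>

lemma dvd_vbase: "i \<le> j \<Longrightarrow> vbase m i dvd vbase m j"
  by (induction j) (auto simp: le_Suc_eq intro: dvd_mult)

lemma vpsi_eq_prod:
  assumes "n < vbase m K"
  shows "vpsi m n x = (\<Prod>k<K. rademacher m k x ^ vdigit m n k)"
proof -
  have "k < K" if "vdigit m n k \<noteq> 0" for k
  proof (rule ccontr)
    assume "\<not> k < K"
    then have "n < vbase m k" using assms vbase_mono[of K k] by simp
    then show False using that by (simp add: vdigit_def)
  qed
  then show ?thesis
    unfolding vpsi_def by (intro prod.mono_neutral_left) auto
qed

lemma vdigit_add_low:
  assumes "j < vbase m A" "k < A"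
  shows "vdigit m (q * vbase m A + j) k = vdigit m j k"
proof -
  have "vbase m (Suc k) dvd vbase m A" using assms by (intro dvd_vbase) simp
  then obtain c where c: "vbase m A = m k * vbase m k * c" by (auto elim: dvdE)
  have "(q * vbase m A + j) div vbase m k = (q * m k * c) + j div vbase m k"
    using div_mult_self1[of "vbase m k" j "q * m k * c"] M_pos[of k] unfolding c
    by (simp add: mult_ac add.commute)
  also have "\<dots> mod m k = j div vbase m k mod m k"
    using mod_mult_self1[of "j div vbase m k" "q * c" "m k"] by (simp add: mult_ac add.commute)
  finally show ?thesis by (simp add: vdigit_def)
qed

text \<open>The index has digit \<open>q\<close> in position \<open>A\<close> and the digits of
  \<open>j\<close> below it. This factorisation drives the kernel recursions.\<close>

lemma vpsi_add:
  assumes "j < vbase m A" "q < m A"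
  shows "vpsi m (q * vbase m A + j) x = rademacher m A x ^ q * vpsi m j x"
proof -
  have "q * vbase m A + j < Suc q * vbase m A" using assms by simp
  also have "\<dots> \<le> vbase m (Suc A)" using assms by (simp only: vbase.simps) (intro mult_right_mono, auto)
  finally have "vpsi m (q * vbase m A + j) x =
      (\<Prod>k<Suc A. rademacher m k x ^ vdigit m (q * vbase m A + j) k)"
    by (rule vpsi_eq_prod)
  also have "vdigit m (q * vbase m A + j) A = q"
    using assms M_pos[of A] by (simp add: vdigit_def)
  then have "(\<Prod>k<Suc A. rademacher m k x ^ vdigit m (q * vbase m A + j) k) =
      rademacher m A x ^ q * (\<Prod>k<A. rademacher m k x ^ vdigit m j k)"
    using assms by (simp add: vdigit_add_low mult.commute)
  finally show ?thesis using vpsi_eq_prod[OF assms(1)] by simp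
qed

lemma norm_rademacher: "norm (rademacher m k x) = 1"
proof -
  have "2 * of_real pi * \<i> * of_nat (x k) / of_nat (m k) = \<i> * complex_of_real (2 * pi * x k / m k)"
    by simp
  then show ?thesis unfolding rademacher_def by (simp only: norm_exp_i_times)
qed

definition rho :: "nat \<Rightarrow> (nat \<Rightarrow> nat) \<Rightarrow> (nat \<Rightarrow> nat) \<Rightarrow> complex" where
  "rho k x y = rademacher m k x * cnj (rademacher m k y)"

lemma norm_rho: "norm (rho k x y) = 1"
  by (simp add: rho_def norm_mult norm_rademacher)

lemma rademacher_cnj: "rademacher m k x * cnj (rademacher m k x) = 1"
  by (simp add: complex_norm_square[symmetric] norm_rademacher)

lemma rademacher_pow: "rademacher m k x ^ m k = 1"
proof -
  have "rademacher m k x ^ m k = exp (of_nat (m k) * (2 * of_real pi * \<i> * of_nat (x k) / of_nat (m k)))"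
    unfolding rademacher_def by (rule exp_of_nat_mult[symmetric])
  also have "of_nat (m k) * (2 * of_real pi * \<i> * of_nat (x k) / of_nat (m k)) = 2 * of_real pi * \<i> * complex_of_nat (x k)"
    using m_pos[of k] by simp
  also have "exp \<dots> = 1"
    using exp_integer_2pi[of "of_nat (x k)"] by (simp add: mult_ac)
  finally show ?thesis .
qed

lemma rademacher_inj:
  assumes "x k < m k" "y k < m k" "rademacher m k x = rademacher m k y"
  shows "x k = y k"
proof -
  have "inj_on (\<lambda>j. exp (2 * of_real pi * \<i> * of_nat j / of_nat (m k))) {..<m k}"
    using bij_betw_roots_unity[of "m k"] m_pos[of k] by (auto simp: bij_betw_def)
  from inj_onD[OF this assms(3)[unfolded rademacher_def]] assms(1,2) show ?thesis by simp
qed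

lemma sum_rho:
  assumes "x \<in> G" "y \<in> G"
  shows "(\<Sum>s<m k. rho k x y ^ s) = (if x k = y k then of_nat (m k) else 0)"
proof (cases "x k = y k")
  case True
  then have "rho k x y = 1"
    using rademacher_cnj[of k x] by (simp add: rho_def rademacher_def)
  then show ?thesis using True by simp
next
  case False
  have "rho k x y \<noteq> 1"
  proof
    assume "rho k x y = 1"
    then have "rademacher m k x * (cnj (rademacher m k y) * rademacher m k y) = rademacher m k y"
      by (simp add: rho_def flip: mult.assoc)
    then have "rademacher m k x = rademacher m k y"
      using rademacher_cnj[of k y] by (simp add: mult.commute)
    with False rademacher_inj[of x k y] assms show False by (auto simp: G_iff)
  qed
  moreover have "rho k x y ^ m k = 1"
    by (simp add: rho_def power_mult_distrib rademacher_pow flip: complex_cnj_power)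
  ultimately show ?thesis using sum_roots_of_unity False by simp
qed

section \<open>Dirichlet and Fejer kernels\<close>

definition dirichlet :: "nat \<Rightarrow> (nat \<Rightarrow> nat) \<Rightarrow> (nat \<Rightarrow> nat) \<Rightarrow> complex" where
  "dirichlet n x y = (\<Sum>k<n. vpsi m k x * cnj (vpsi m k y))"

text \<open>This is \<open>n\<close> times the usual Fejer kernel.\<close>

definition fejer :: "nat \<Rightarrow> (nat \<Rightarrow> nat) \<Rightarrow> (nat \<Rightarrow> nat) \<Rightarrow> complex" where
  "fejer n x y = (\<Sum>k=1..n. dirichlet k x y)"

lemma dirichlet_add:
  assumes "j \<le> vbase m A" "q < m A"
  shows "dirichlet (q * vbase m A + j) x y = dirichlet (q * vbase m A) x y + rho A x y ^ q * dirichlet j x y"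
  using assms
proof (induction j)
  case 0
  then show ?case by (simp add: dirichlet_def)
next
  case (Suc j)
  have "dirichlet (Suc k) x y = dirichlet k x y + vpsi m k x * cnj (vpsi m k y)" for k
    by (simp add: dirichlet_def)
  then show ?case
    using Suc vpsi_add[of j A q x] vpsi_add[of j A q y]
    by (simp add: rho_def power_mult_distrib distrib_left mult_ac)
qed

lemma dirichlet_mult:
  assumes "p \<le> m A"
  shows "dirichlet (p * vbase m A) x y = (\<Sum>s<p. rho A x y ^ s) * dirichlet (vbase m A) x y"
  using assms
proof (induction p)
  case 0
  then show ?case by (simp add: dirichlet_def)
next
  case (Suc p)
  then show ?case
    using dirichlet_add[of "vbase m A" A p x y] by (simp add: algebra_simps)
qed

text \<open>Passing from rank \<open>A\<close> to \<open>Suc A\<close> multiplies the kernel by the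
  full geometric sum of \<open>rho A x y\<close>, which is \<open>m A\<close> if coordinate
  \<open>A\<close> agrees and 0 otherwise.\<close>

lemma dirichlet_vbase:
  assumes "x \<in> G" "y \<in> G"
  shows "dirichlet (vbase m A) x y = of_real (M A * of_bool (agree A A x y))"
proof (induction A)
  case 0
  then show ?case by (simp add: dirichlet_def agree_def vpsi_eq_prod[of 0 0])
next
  case (Suc A)
  have "agree (Suc A) (Suc A) x y \<longleftrightarrow> agree A A x y \<and> x A = y A"
    by (auto simp: agree_def less_Suc_eq)
  then show ?case
    using dirichlet_mult[of "m A" A x y] Suc sum_rho[OF assms, of A] by simp
qed

text \<open>By \<open>dirichlet_add\<close>, each of the \<open>j\<close> Dirichlet kernels past
  index \<open>q * vbase m A\<close> is the kernel reached there plus a rotated short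
  kernel.\<close>

lemma fejer_add:
  assumes "j \<le> vbase m A" "q < m A"
  shows "fejer (q * vbase m A + j) x y = fejer (q * vbase m A) x y
    + of_nat j * dirichlet (q * vbase m A) x y + rho A x y ^ q * fejer j x y"
  using assms
proof (induction j)
  case 0
  then show ?case by (simp add: fejer_def)
next
  case (Suc j)
  have "fejer (q * vbase m A + Suc j) x y = fejer (q * vbase m A + j) x y + dirichlet (q * vbase m A + Suc j) x y"
    by (simp add: fejer_def)
  moreover have "fejer (Suc j) x y = fejer j x y + dirichlet (Suc j) x y" by (simp add: fejer_def)
  ultimately show ?case
    using Suc dirichlet_add[of "Suc j" A q x y] by (simp add: algebra_simps)
qed

lemma fejer_mult:
  assumes "q \<le> m A"
  shows "fejer (q * vbase m A) x y = (\<Sum>p<q. rho A x y ^ p) * fejer (vbase m A) x y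
    + of_nat (vbase m A) * dirichlet (vbase m A) x y * (\<Sum>p<q. \<Sum>s<p. rho A x y ^ s)"
  using assms
proof (induction q)
  case 0
  then show ?case by (simp add: fejer_def)
next
  case (Suc q)
  then show ?case
    using fejer_add[of "vbase m A" A q x y] dirichlet_mult[of q A x y] by (simp add: algebra_simps)
qed

text \<open>Up to the factor \<open>B\<^sup>2\<close>, a majorant of the Fejer kernel at index
  \<open>vbase m A\<close>. The summand \<open>t = A\<close> is the diagonal part.\<close>

definition block :: "nat \<Rightarrow> (nat \<Rightarrow> nat) \<Rightarrow> (nat \<Rightarrow> nat) \<Rightarrow> real" where
  "block A x y = M A * (\<Sum>t\<le>A. M t * of_bool (agree t A x y))"

lemma block_nonneg: "block A x y \<ge> 0"
  unfolding block_def using M_pos by (intro mult_nonneg_nonneg sum_nonneg) (auto simp: less_imp_le)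

lemma M_le_block: "M A * (M A * of_bool (agree A A x y)) \<le> block A x y"
  unfolding block_def using M_pos
  by (intro mult_left_mono member_le_sum[of A "{..A}" "\<lambda>t. M t * of_bool (agree t A x y)"]) (auto simp: less_imp_le)

lemma norm_sum_rho: "norm (\<Sum>p<q. rho A x y ^ p) \<le> real q"
proof -
  have "norm (\<Sum>p<q. rho A x y ^ p) \<le> (\<Sum>p<q. norm (rho A x y ^ p))" by (rule norm_sum)
  then show ?thesis by (simp add: norm_power norm_rho)
qed

lemma norm_sum_sum_rho:
  assumes "real q \<le> B"
  shows "norm (\<Sum>p<q. \<Sum>s<p. rho A x y ^ s) \<le> B\<^sup>2"
proof -
  have "norm (\<Sum>p<q. \<Sum>s<p. rho A x y ^ s) \<le> (\<Sum>p<q. real p)"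
    using norm_sum_rho by (intro sum_norm_le) auto
  also have "\<dots> \<le> (\<Sum>p<q. real q)" by (intro sum_mono) auto
  also have "\<dots> = real q * real q" by simp
  also have "\<dots> \<le> B * B" using assms by (intro mult_mono) auto
  finally show ?thesis by (simp add: power2_eq_square)
qed

text \<open>In \<open>fejer_mult\<close> with \<open>q = m A\<close>, the full sum of powers of
  \<open>rho\<close> forces agreement in position \<open>A\<close> and supplies the factor
  \<open>m A\<close>, which lifts the old summands to rank \<open>Suc A\<close>. The Dirichlet term
  leaves position \<open>A\<close> free and is absorbed by the new summand
  \<open>t = A\<close>.\<close>

lemma norm_fejer_vbase:
  assumes "x \<in> G" "y \<in> G"
  shows "norm (fejer (vbase m A) x y) \<le> B\<^sup>2 * block A x y"
proof (induction A)
  case 0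
  have "1 \<le> B * B" using mult_mono[of 1 B 1 B] B_ge_2 by simp
  then show ?case by (simp add: fejer_def dirichlet_def agree_def block_def vpsi_eq_prod[of 0 0] power2_eq_square)
next
  case (Suc A)
  let ?e = "of_bool (x A = y A) :: real"
  let ?a = "of_bool (agree A A x y) :: real"
  have "norm (fejer (vbase m (Suc A)) x y) \<le>
     norm (\<Sum>p<m A. rho A x y ^ p) * norm (fejer (vbase m A) x y) +
     M A * norm (dirichlet (vbase m A) x y) * norm (\<Sum>p<m A. \<Sum>s<p. rho A x y ^ s)"
    using fejer_mult[of "m A" A x y] by (auto simp: norm_mult intro!: order_trans[OF norm_triangle_ineq])
  also have "\<dots> \<le> (m A * ?e) * (B\<^sup>2 * block A x y) + M A * (M A * ?a) * B\<^sup>2"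
    using Suc sum_rho[OF assms, of A] norm_sum_sum_rho[OF m_le_B] M_pos[of A] block_nonneg[of A x y]
    by (intro add_mono mult_mono) (auto simp: dirichlet_vbase[OF assms])
  also have "\<dots> = B\<^sup>2 * (M (Suc A) * (\<Sum>t\<le>A. M t * (?e * of_bool (agree t A x y))) + M A * M A * ?a)"
    by (cases "x A = y A") (simp_all add: block_def algebra_simps)
  also have "\<dots> \<le> B\<^sup>2 * block (Suc A) x y"
  proof (intro mult_left_mono)
    have split: "(\<Sum>t\<le>A. M t * f t) = (\<Sum>t<A. M t * f t) + M A * f A" for f :: "nat \<Rightarrow> real"
      by (simp flip: lessThan_Suc_atMost)
    have low: "(\<Sum>t<A. M t * (?e * of_bool (agree t A x y))) \<le> (\<Sum>t<A. M t * of_bool (agree t (Suc A) x y))"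
      using M_pos by (intro sum_mono) (auto simp: agree_def less_Suc_eq)
    have aS: "agree A (Suc A) x y \<longleftrightarrow> agree A A x y"
      "agree (Suc A) (Suc A) x y \<longleftrightarrow> agree A A x y \<and> x A = y A"
      by (auto simp: agree_def less_Suc_eq)
    have MM: "M A * M A \<le> M (Suc A) * M A" "M A * M A \<le> M (Suc A) * M (Suc A)"
      using M_mono[of A "Suc A"] M_pos[of A] by (auto intro!: mult_mono simp del: vbase.simps)
    have "M (Suc A) * (\<Sum>t\<le>A. M t * (?e * of_bool (agree t A x y))) + M A * M A * ?a
      \<le> M (Suc A) * (\<Sum>t<A. M t * of_bool (agree t (Suc A) x y)) + (M (Suc A) * M A * (?e * ?a) + M A * M A * ?a)"
      unfolding split distrib_left using low M_pos[of "Suc A"] by (auto intro: mult_left_mono simp del: vbase.simps)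
    \<comment> \<open>These leftovers are compared with the summands \<open>t = A\<close> and
      \<open>t = Suc A\<close> of the new block; the former requires no agreement in position
      \<open>A\<close>.\<close>
    also have "M (Suc A) * M A * (?e * ?a) + M A * M A * ?a \<le>
        M (Suc A) * M A * ?a + M (Suc A) * M (Suc A) * (?e * ?a)"
      using MM M_pos[of A] M_pos[of "Suc A"] by (auto simp del: vbase.simps)
    finally have "M (Suc A) * (\<Sum>t\<le>A. M t * (?e * of_bool (agree t A x y))) + M A * M A * ?a \<le>
        M (Suc A) * (\<Sum>t<A. M t * of_bool (agree t (Suc A) x y)) +
        (M (Suc A) * M A * ?a + M (Suc A) * M (Suc A) * (?e * ?a))"
      by linarith
    moreover have "(\<Sum>t\<le>Suc A. M t * of_bool (agree t (Suc A) x y)) =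
        (\<Sum>t<A. M t * of_bool (agree t (Suc A) x y)) + M A * ?a + M (Suc A) * (?e * ?a)"
      unfolding sum.atMost_Suc split aS of_bool_conj by (simp only: mult.commute)
    ultimately show "M (Suc A) * (\<Sum>t\<le>A. M t * (?e * of_bool (agree t A x y))) + M A * M A * ?a \<le> block (Suc A) x y"
      unfolding block_def by (simp only: distrib_left mult.assoc add.assoc)
  qed simp
  finally show ?case .
qed

lemma finite_vbase_le: "finite {A. vbase m A \<le> n}"
proof (rule finite_subset)
  show "{A. vbase m A \<le> n} \<subseteq> {..<n}"
    using less_vbase by (auto intro: less_le_trans)
qed simp

text \<open>Leading digits are split off one by one, each adding at most one block. The remainder
  enters only through a factor of modulus one, so the constant does not grow with the number of
  digits.\<close>

lemma norm_fejer_le: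
  assumes "x \<in> G" "y \<in> G"
  shows "norm (fejer n x y) \<le> 3 * B^3 * (\<Sum>A | vbase m A \<le> n. block A x y)"
proof -
  let ?C = "3 * B^3"
  have "\<forall>n<vbase m K. norm (fejer n x y) \<le> ?C * (\<Sum>A | vbase m A \<le> n. block A x y)" for K
  proof (induction K)
    case 0
    then show ?case using B_ge_2 by (auto simp: fejer_def intro!: mult_nonneg_nonneg sum_nonneg block_nonneg)
  next
    case (Suc K)
    show ?case
    proof (intro allI impI)
      fix n assume n: "n < vbase m (Suc K)"
      show "norm (fejer n x y) \<le> ?C * (\<Sum>A | vbase m A \<le> n. block A x y)"
      proof (cases "n < vbase m K")
        case True
        then show ?thesis using Suc by simp
      next
        case False
        define q j where "q = n div vbase m K" and "j = n mod vbase m K"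
        have j: "j < vbase m K" and q: "q < m K" and n_eq: "n = q * vbase m K + j"
          using n M_pos[of K] by (auto simp: q_def j_def less_mult_imp_div_less mult.commute)
        have qB: "real q \<le> B" using q m_le_B[of K] by linarith
        let ?b = "block K x y"
        have D: "M K * norm (dirichlet (vbase m K) x y) \<le> ?b"
          using M_le_block[of K x y] block_nonneg[of K x y] M_pos[of K]
          by (cases "agree K K x y") (simp_all add: dirichlet_vbase[OF assms])
        have "norm (fejer (q * vbase m K) x y) \<le> norm (\<Sum>p<q. rho K x y ^ p) * norm (fejer (vbase m K) x y) +
           (M K * norm (dirichlet (vbase m K) x y)) * norm (\<Sum>p<q. \<Sum>s<p. rho K x y ^ s)"
          using fejer_mult[of q K x y] q by (auto simp: norm_mult intro!: order_trans[OF norm_triangle_ineq])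
        also have "\<dots> \<le> B * (B\<^sup>2 * ?b) + ?b * B\<^sup>2"
          using norm_sum_rho[of K x y q] qB norm_sum_sum_rho[OF qB] norm_fejer_vbase[OF assms, of K] D block_nonneg[of K x y] B_ge_2
          by (intro add_mono mult_mono) auto
        finally have 1: "norm (fejer (q * vbase m K) x y) \<le> B * (B\<^sup>2 * ?b) + ?b * B\<^sup>2" .
        have "norm (of_nat j * dirichlet (q * vbase m K) x y) =
            real j * (norm (\<Sum>s<q. rho K x y ^ s) * norm (dirichlet (vbase m K) x y))"
          using dirichlet_mult[of q K x y] q by (simp add: norm_mult)
        also have "\<dots> \<le> M K * (B * norm (dirichlet (vbase m K) x y))"
          using j norm_sum_rho[of K x y q] qB by (intro mult_mono) auto
        also have "\<dots> \<le> B * ?b" using mult_left_mono[OF D, of B] B_ge_2 by (simp add: mult_ac)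
        finally have 2: "norm (of_nat j * dirichlet (q * vbase m K) x y) \<le> B * ?b" .
        have 3: "norm (rho K x y ^ q * fejer j x y) \<le> ?C * (\<Sum>A | vbase m A \<le> j. block A x y)"
          using Suc j by (simp add: norm_mult norm_power norm_rho)
        have "norm (fejer n x y) \<le> norm (fejer (q * vbase m K) x y) + norm (of_nat j * dirichlet (q * vbase m K) x y)
            + norm (rho K x y ^ q * fejer j x y)"
          using fejer_add[of j K q x y] j q norm_triangle_ineq[of "fejer (q * vbase m K) x y + of_nat j * dirichlet (q * vbase m K) x y" "rho K x y ^ q * fejer j x y"]
            norm_triangle_ineq[of "fejer (q * vbase m K) x y" "of_nat j * dirichlet (q * vbase m K) x y"]
          unfolding n_eq by simp
        also have "\<dots> \<le> B * (B\<^sup>2 * ?b) + ?b * B\<^sup>2 + B * ?b + ?C * (\<Sum>A | vbase m A \<le> j. block A x y)"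
          using 1 2 3 by linarith
        \<comment> \<open>The three estimates for the leading digit amount to
          \<open>B^3 + B\<^sup>2 + B\<close> blocks, whence the constant
          \<open>3 * B^3\<close>.\<close>
        also have "B * (B\<^sup>2 * ?b) + ?b * B\<^sup>2 + B * ?b \<le> ?C * ?b"
        proof -
          have "B\<^sup>2 \<le> B^3" "B^1 \<le> B^3" using B_ge_2 by (intro power_increasing; simp)+
          then have "B^3 + B\<^sup>2 + B \<le> ?C" by simp
          from mult_right_mono[OF this block_nonneg[of K x y]] show ?thesis
            by (simp add: algebra_simps power3_eq_cube power2_eq_square)
        qed
        \<comment> \<open>Rank \<open>K\<close> is not among the ranks of the remainder, since
          \<open>j < vbase m K\<close>.\<close>
        also have "?C * ?b + ?C * (\<Sum>A | vbase m A \<le> j. block A x y) = ?C * (\<Sum>A\<in>insert K {A. vbase m A \<le> j}. block A x y)"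
          using j finite_vbase_le[of j] by (subst sum.insert) (auto simp: distrib_left)
        also have "\<dots> \<le> ?C * (\<Sum>A | vbase m A \<le> n. block A x y)"
          using False B_ge_2 block_nonneg finite_vbase_le[of n] j 
          by (intro mult_left_mono sum_mono2) auto
        finally show ?thesis by simp
      qed
    qed
  qed
  from this[of n] show ?thesis using less_vbase[of n] by simp
qed

end

section \<open>Integral estimates for the kernel\<close>

lemma sum_if_mult:
  fixes f :: "'a \<Rightarrow> 'b::semiring_0"
  assumes "finite I"
  shows "(\<Sum>i\<in>I. if P i then c * f i else 0) = c * (\<Sum>i\<in>{i\<in>I. P i}. f i)"
  using assms by (auto simp: sum.inter_filter sum_distrib_left intro!: sum.cong)

context bounded_vilenkin
begin

section \<open>Geometric sums over ranks\<close>

lemma sum_M_atMost: "(\<Sum>t\<le>T. M t) \<le> 2 * M T"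
proof (induction T)
  case (Suc T)
  then show ?case using M_Suc_ge[of T] by (simp del: vbase.simps)
qed simp

lemma sum_M_le:
  assumes "finite S" "\<And>t. t \<in> S \<Longrightarrow> M t \<le> y" "y \<ge> 0"
  shows "(\<Sum>t\<in>S. M t) \<le> 2 * y"
proof (cases "S = {}")
  case False
  have "(\<Sum>t\<in>S. M t) \<le> (\<Sum>t\<le>Max S. M t)"
    using assms(1) by (intro sum_mono2) auto
  also have "\<dots> \<le> 2 * M (Max S)" by (rule sum_M_atMost)
  also have "\<dots> \<le> 2 * y" using assms False by simp
  finally show ?thesis .
qed (use assms in simp)

lemma sum_inverse_M_ivl: "(\<Sum>A\<in>{T..T+d}. 1 / M A) \<le> 2 / M T - 1 / M (T + d)"
proof (induction d)
  case (Suc d)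
  have "2 / M (Suc (T + d)) \<le> 1 / M (T + d)"
    using M_Suc_ge[of "T + d"] M_pos[of "T + d"] M_pos[of "Suc (T + d)"]
    by (simp add: divide_simps del: vbase.simps)
  then have "2 / M T - 1 / M (T + d) + 1 / M (Suc (T + d)) \<le> 2 / M T - 1 / M (Suc (T + d))"
    by (simp del: vbase.simps)
  with Suc show ?case by (simp del: vbase.simps)
qed simp

lemma sum_inverse_M_tail:
  assumes "finite S" "\<And>A. A \<in> S \<Longrightarrow> T \<le> A"
  shows "(\<Sum>A\<in>S. 1 / M A) \<le> 2 / M T"
proof (cases "S = {}")
  case False
  then have "T \<le> Max S" using assms by simp
  then obtain d where d: "Max S = T + d" using le_Suc_ex by blast
  have "(\<Sum>A\<in>S. 1 / M A) \<le> (\<Sum>A\<in>{T..T+d}. 1 / M A)"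
    using assms d Max_ge[OF assms(1)] by (intro sum_mono2) auto
  also have "\<dots> \<le> 2 / M T - 1 / M (T + d)" by (rule sum_inverse_M_ivl)
  also have "\<dots> \<le> 2 / M T" using M_pos[of "T + d"] by simp
  finally show ?thesis .
qed simp

lemma sum_inverse_M_le:
  assumes "finite S" "\<And>A. A \<in> S \<Longrightarrow> y < M A" "y > 0"
  shows "(\<Sum>A\<in>S. 1 / M A) \<le> 2 / y"
proof (cases "S = {}")
  case False
  have "(\<Sum>A\<in>S. 1 / M A) \<le> 2 / M (Min S)"
    using assms by (intro sum_inverse_M_tail) auto
  also have "\<dots> \<le> 2 / y" using assms(2)[of "Min S"] assms(1,3) False by (intro divide_left_mono) auto
  finally show ?thesis .
qed (use assms in simp)

text \<open>Split at \<open>M t = y\<close>. If \<open>M t > y\<close>, the sum over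
  \<open>A \<ge> t\<close> is at most \<open>2 / M t\<close>; otherwise the condition forces
  \<open>M A > y\<^sup>2 / M t\<close>, and the sum over \<open>A\<close> is at most
  \<open>2 * M t / y\<^sup>2\<close>. Summing over \<open>t\<close> gives \<open>4 / y\<close>
  twice, with no factor counting the ranks.\<close>

lemma double_sum_large:
  assumes "y > 0"
  shows "(\<Sum>A\<le>N. \<Sum>t\<le>A. if M A * M t > y\<^sup>2 then 1 / M A else 0) \<le> 8 / y"
proof -
  let ?a = "\<lambda>A t. if t \<le> A \<and> y < M t then 1 / M A else 0"
  let ?b = "\<lambda>A t. if M t \<le> y \<and> y\<^sup>2 / M t < M A then 1 / M A else 0"
  have M0: "0 < M t" for t by (rule M_pos)
  have "(\<Sum>A\<le>N. \<Sum>t\<le>A. if M A * M t > y\<^sup>2 then 1 / M A else 0) \<le> (\<Sum>A\<le>N. \<Sum>t\<le>A. ?a A t + ?b A t)"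
  proof (intro sum_mono)
    fix A t :: nat assume "t \<in> {..A}"
    then show "(if M A * M t > y\<^sup>2 then 1 / M A else 0) \<le> ?a A t + ?b A t"
      using M0[of A] M0[of t] by (simp add: divide_less_eq)
  qed
  also have "\<dots> \<le> (\<Sum>A\<le>N. \<Sum>t\<le>N. ?a A t + ?b A t)"
    by (intro sum_mono sum_mono2) auto
  also have "\<dots> = (\<Sum>t\<le>N. \<Sum>A\<le>N. ?a A t) + (\<Sum>t\<le>N. \<Sum>A\<le>N. ?b A t)"
    by (subst sum.swap) (simp add: sum.distrib)
  also have "(\<Sum>t\<le>N. \<Sum>A\<le>N. ?a A t) \<le> (\<Sum>t\<le>N. if y < M t then 2 * (1 / M t) else 0)"
  proof (intro sum_mono)
    fix t
    have "(\<Sum>A\<le>N. if t \<le> A then 1 / M A else 0) = (\<Sum>A\<in>{A\<in>{..N}. t \<le> A}. 1 / M A)"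
      by (rule sum.inter_filter[symmetric]) simp
    also have "\<dots> \<le> 2 / M t"
      by (rule sum_inverse_M_tail) auto
    finally show "(\<Sum>A\<le>N. ?a A t) \<le> (if y < M t then 2 * (1 / M t) else 0)"
      by (cases "y < M t") simp_all
  qed
  also have "(\<Sum>t\<le>N. if y < M t then 2 * (1 / M t) else 0) = 2 * (\<Sum>t\<in>{t\<in>{..N}. y < M t}. 1 / M t)"
    by (rule sum_if_mult) simp
  also have "\<dots> \<le> 2 * (2 / y)"
    using assms by (intro mult_left_mono sum_inverse_M_le) auto
  also have "(\<Sum>t\<le>N. \<Sum>A\<le>N. ?b A t) \<le> (\<Sum>t\<le>N. if M t \<le> y then 2 / y\<^sup>2 * M t else 0)"
  proof (intro sum_mono)
    fix t
    have "(\<Sum>A\<le>N. if y\<^sup>2 / M t < M A then 1 / M A else 0) = (\<Sum>A\<in>{A\<in>{..N}. y\<^sup>2 / M t < M A}. 1 / M A)"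
      by (rule sum.inter_filter[symmetric]) simp
    also have "\<dots> \<le> 2 / (y\<^sup>2 / M t)"
      using assms M0[of t] by (intro sum_inverse_M_le) simp_all
    finally show "(\<Sum>A\<le>N. ?b A t) \<le> (if M t \<le> y then 2 / y\<^sup>2 * M t else 0)"
      by (cases "M t \<le> y") simp_all
  qed
  also have "(\<Sum>t\<le>N. if M t \<le> y then 2 / y\<^sup>2 * M t else 0) = 2 / y\<^sup>2 * (\<Sum>t\<in>{t\<in>{..N}. M t \<le> y}. M t)"
    by (rule sum_if_mult) simp
  also have "\<dots> \<le> 2 / y\<^sup>2 * (2 * y)"
    using assms by (intro mult_left_mono sum_M_le) auto
  also have "2 * (2 / y) + 2 / y\<^sup>2 * (2 * y) = 8 / y"
    using assms by (simp add: power2_eq_square)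
  finally show ?thesis by simp
qed

text \<open>For \<open>M A \<le> y\<close> the inner sum is at most \<open>2 * M A\<close>; for
  larger \<open>M A\<close> it is cut off at \<open>y\<^sup>2 / M A\<close>. Each case contributes
  \<open>4 * y\<close>.\<close>

lemma double_sum_small:
  assumes "y > 0"
  shows "(\<Sum>A\<le>N. \<Sum>t\<le>A. if M A * M t \<le> y\<^sup>2 then M t else 0) \<le> 8 * y"
proof -
  have "(\<Sum>A\<le>N. \<Sum>t\<le>A. if M A * M t \<le> y\<^sup>2 then M t else 0) \<le>
      (\<Sum>A\<le>N. (if M A \<le> y then 2 * M A else 0) + (if y < M A then 2 * y\<^sup>2 * (1 / M A) else 0))"
  proof (intro sum_mono)
    fix A
    show "(\<Sum>t\<le>A. if M A * M t \<le> y\<^sup>2 then M t else 0) \<le>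
       (if M A \<le> y then 2 * M A else 0) + (if y < M A then 2 * y\<^sup>2 * (1 / M A) else 0)"
    proof (cases "M A \<le> y")
      case True
      have "(\<Sum>t\<le>A. if M A * M t \<le> y\<^sup>2 then M t else 0) \<le> (\<Sum>t\<le>A. M t)" by (intro sum_mono) auto
      also have "\<dots> \<le> 2 * M A" by (rule sum_M_atMost)
      finally show ?thesis using True by simp
    next
      case False
      have "(\<Sum>t\<le>A. if M A * M t \<le> y\<^sup>2 then M t else 0) = (\<Sum>t\<in>{t\<in>{..A}. M A * M t \<le> y\<^sup>2}. M t)"
        by (simp only: sum.inter_filter[OF finite_atMost])
      also have "\<dots> \<le> 2 * (y\<^sup>2 / M A)"
        using M_pos[of A] by (intro sum_M_le) (auto simp: le_divide_eq mult.commute)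
      finally show ?thesis using False by simp
    qed
  qed
  also have "\<dots> = 2 * (\<Sum>A\<in>{A\<in>{..N}. M A \<le> y}. M A) + 2 * y\<^sup>2 * (\<Sum>A\<in>{A\<in>{..N}. y < M A}. 1 / M A)"
    by (simp only: sum.distrib sum_if_mult[OF finite_atMost])
  also have "\<dots> \<le> 2 * (2 * y) + 2 * y\<^sup>2 * (2 / y)"
    using assms by (intro add_mono mult_left_mono sum_M_le sum_inverse_M_le) auto
  also have "\<dots> = 8 * y" using assms by (simp add: power2_eq_square)
  finally show ?thesis .
qed

section \<open>Integration against the Fejer kernel\<close>

lemma cylindrical_vpsi:
  assumes "n < vbase m K"
  shows "cylindrical K (vpsi m n)"
proof -
  have "cylindrical K (\<lambda>x. \<Prod>k<K. rademacher m k x ^ vdigit m n k)"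
    by (intro cylindrical_prod cylindricalI) (simp add: rademacher_def)
  then show ?thesis by (simp add: vpsi_eq_prod[OF assms, abs_def])
qed

lemma cylindrical_fejer:
  assumes "n \<le> vbase m K"
  shows "cylindrical K (\<lambda>y. fejer n x y)"
  unfolding fejer_def dirichlet_def
  using assms by (intro cylindrical_sum cylindrical_comp[of K _ "\<lambda>u. c * cnj u" for c] cylindrical_vpsi) auto

lemma cylindrical_fejer': "\<exists>K. cylindrical K (\<lambda>y. fejer n x y)"
  using cylindrical_fejer[of n n x] less_vbase[of n] by auto

lemma integral_of_bool:
  "(\<integral>y. of_bool (Q y) \<partial>vilenkin m) = prob {y\<in>G. Q y}"
proof -
  have "(\<integral>y. of_bool (Q y) \<partial>vilenkin m) = (\<integral>y. indicator {y\<in>G. Q y} y \<partial>vilenkin m :: real)"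
    by (intro Bochner_Integration.integral_cong) (auto simp: indicator_def)
  also have "\<dots> = prob ({y\<in>G. Q y} \<inter> G)" by simp
  also have "{y\<in>G. Q y} \<inter> G = {y\<in>G. Q y}" by auto
  finally show ?thesis .
qed

lemma integral_sum_of_bool:
  fixes d :: "'b \<Rightarrow> real"
  assumes "\<And>t. t \<in> I \<Longrightarrow> integrable (vilenkin m) (\<lambda>y. of_bool (Q t y) :: real)"
  shows "(\<integral>y. c * (\<Sum>t\<in>I. d t * of_bool (Q t y)) \<partial>vilenkin m) = c * (\<Sum>t\<in>I. d t * prob {y\<in>G. Q t y})"
  using assms
  by (simp add: integral_of_bool Bochner_Integration.integral_sum del: sum_mult_of_bool_eq sum_of_bool_mult_eq)

lemma integrable_of_bool_agree: "integrable (vilenkin m) (\<lambda>y. of_bool (agree t A x y) :: real)"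
  by (rule cylindrical_integrable[of A]) (intro cylindrical_comp[of A _ of_bool] cylindrical_agree order_refl)

lemma cylindrical_block: "cylindrical A (\<lambda>y. block A x y)"
  unfolding block_def
  by (intro cylindrical_comp[of A _ "\<lambda>u. c * u" for c] cylindrical_sum cylindrical_comp[of A _ of_bool] cylindrical_agree order_refl)

lemma integral_block_le:
  assumes "x \<in> G"
  shows "(\<integral>y. block A x y \<partial>vilenkin m) \<le> 2 * B * M A"
proof -
  have "(\<integral>y. block A x y \<partial>vilenkin m) = M A * (\<Sum>t\<le>A. M t * prob {y\<in>G. agree t A x y})"
    unfolding block_def by (intro integral_sum_of_bool integrable_of_bool_agree)
  also have "\<dots> \<le> M A * (\<Sum>t\<le>A. M t * (B / M A))"
    using M_pos by (intro mult_left_mono sum_mono prob_agree_le assms) (auto simp: less_imp_le)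
  also have "\<dots> = B * (\<Sum>t\<le>A. M t)" using M_pos[of A] by (simp add: sum_distrib_left sum_distrib_right mult.commute)
  also have "\<dots> \<le> B * (2 * M A)" using sum_M_atMost B_ge_2 by (intro mult_left_mono) auto
  finally show ?thesis by simp
qed

text \<open>The factor \<open>n\<close> of \<open>fejer\<close> is kept, so bounds for the means
  appear as bounds linear in \<open>n\<close>.\<close>

definition conv :: "nat \<Rightarrow> ((nat \<Rightarrow> nat) \<Rightarrow> complex) \<Rightarrow> (nat \<Rightarrow> nat) \<Rightarrow> complex" where
  "conv n g x = (\<integral>y. g y * fejer n x y \<partial>vilenkin m)"

text \<open>The majorant \<open>h\<close> stays inside the integral: a constant serves for bounded
  functions, a multiple of the indicator of an interval for atoms.\<close>

lemma norm_conv_le_sum: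
  assumes "x \<in> G" "cylindrical L g" "cylindrical L h" "\<And>y. y \<in> G \<Longrightarrow> norm (g y) \<le> h y"
  shows "norm (conv n g x) \<le> 3 * B^3 * (\<Sum>A | vbase m A \<le> n. \<integral>y. h y * block A x y \<partial>vilenkin m)"
proof -
  obtain K where K: "cylindrical K (\<lambda>y. fejer n x y)" using cylindrical_fejer' by blast
  have int: "integrable (vilenkin m) (\<lambda>y. h y * block A x y)" for A
    by (rule cylindrical_integrable[of "max L A"])
       (intro cylindrical_comp2[of _ _ _ "(*)"] cylindrical_mono[OF assms(3)] cylindrical_mono[OF cylindrical_block]; simp)
  have "norm (conv n g x) \<le> (\<integral>y. norm (g y * fejer n x y) \<partial>vilenkin m)"
    unfolding conv_def by (rule integral_norm_bound)
  also have "\<dots> \<le> (\<integral>y. 3 * B^3 * (\<Sum>A | vbase m A \<le> n. h y * block A x y) \<partial>vilenkin m)"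
  proof (rule integral_mono)
    show "integrable (vilenkin m) (\<lambda>y. norm (g y * fejer n x y))"
      by (rule cylindrical_integrable[of "max L K"])
         (intro cylindrical_comp[of _ _ norm] cylindrical_comp2[of _ _ _ "(*)"] cylindrical_mono[OF assms(2)] cylindrical_mono[OF K]; simp)
    show "integrable (vilenkin m) (\<lambda>y. 3 * B^3 * (\<Sum>A | vbase m A \<le> n. h y * block A x y))"
      using int by auto
    fix y assume y: "y \<in> G"
    have "norm (g y * fejer n x y) \<le> h y * (3 * B^3 * (\<Sum>A | vbase m A \<le> n. block A x y))"
      unfolding norm_mult using assms(4)[OF y] norm_fejer_le[OF assms(1) y]
      by (intro mult_mono) (auto intro: order_trans[OF norm_ge_zero])
    then show "norm (g y * fejer n x y) \<le> 3 * B^3 * (\<Sum>A | vbase m A \<le> n. h y * block A x y)"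
      by (simp add: sum_distrib_left mult_ac)
  qed
  also have "\<dots> = 3 * B^3 * (\<Sum>A | vbase m A \<le> n. \<integral>y. h y * block A x y \<partial>vilenkin m)"
    using int by (simp add: Bochner_Integration.integral_sum)
  finally show ?thesis .
qed

text \<open>Uniform boundedness of the Fejer means on bounded functions: a block integrates to at
  most \<open>2 * B * M A\<close>, and the \<open>M A\<close> up to \<open>n\<close> sum to at most
  \<open>2 * n\<close>.\<close>

lemma norm_conv_le:
  assumes "x \<in> G" "cylindrical L g" "\<And>y. y \<in> G \<Longrightarrow> norm (g y) \<le> H" "H \<ge> 0"
  shows "norm (conv n g x) \<le> 12 * B^4 * H * n"
proof -
  have "norm (conv n g x) \<le> 3 * B^3 * (\<Sum>A | vbase m A \<le> n. \<integral>y. H * block A x y \<partial>vilenkin m)"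
    using assms by (intro norm_conv_le_sum cylindrical_const) auto
  also have "\<dots> \<le> 3 * B^3 * (\<Sum>A | vbase m A \<le> n. H * (2 * B * M A))"
    using assms(4) integral_block_le[OF assms(1)] B_ge_2 by (intro mult_left_mono sum_mono) (auto intro!: mult_left_mono)
  also have "(\<Sum>A | vbase m A \<le> n. H * (2 * B * M A)) = H * (2 * B) * (\<Sum>A | vbase m A \<le> n. M A)"
    by (simp add: sum_distrib_left mult_ac)
  also have "3 * B^3 * \<dots> \<le> 3 * B^3 * (H * (2 * B) * (2 * real n))"
    using assms(4) B_ge_2 finite_vbase_le by (intro mult_left_mono sum_M_le) auto
  finally show ?thesis by (simp add: power_numeral_reduce mult_ac)
qed

text \<open>A point \<open>y\<close> of the set takes its coordinates below \<open>N\<close> from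
  \<open>z\<close> and agrees with \<open>x\<close> below \<open>A\<close> except at
  \<open>t\<close>. Since \<open>x\<close> is off the interval, the disagreement must sit at
  \<open>t < N\<close>. All coordinates of \<open>y\<close> below \<open>A\<close> are then
  determined, so the set lies in one interval of rank \<open>A\<close> and no factor
  \<open>B\<close> arises.\<close>

lemma prob_vinterval_agree_le:
  assumes "x \<in> G" "z \<in> G" "x \<notin> vinterval m N z" "N < A"
  shows "prob {y\<in>G. y \<in> vinterval m N z \<and> agree t A x y} \<le> of_bool (t < N \<and> agree t N z x) / M A"
proof (cases "{y\<in>G. y \<in> vinterval m N z \<and> agree t A x y} = {}")
  case True
  then show ?thesis using M_pos[of A] by (simp only: measure_empty) auto
next
  case False
  then obtain w where w: "w \<in> G" "w \<in> vinterval m N z" "agree t A x w" by blast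
  have wz: "w j = z j" if "j < N" for j using w that by (auto simp: vinterval_def)
  have wx: "x j = w j" if "j < A" "j \<noteq> t" for j using w that by (auto simp: agree_def)
  have t: "t < N"
  proof (rule ccontr)
    assume "\<not> t < N"
    then have "x \<in> vinterval m N z" using assms wz wx by (auto simp: vinterval_def)
    with assms show False by simp
  qed
  moreover have "agree t N z x" using wz wx assms by (auto simp: agree_def)
  moreover have "{y\<in>G. y \<in> vinterval m N z \<and> agree t A x y} \<subseteq> vinterval m A w"
  proof
    fix y assume y: "y \<in> {y\<in>G. y \<in> vinterval m N z \<and> agree t A x y}"
    have "y j = w j" if "j < A" for j
    proof (cases "j < N")
      case True
      then show ?thesis using y wz by (auto simp: vinterval_def)
    next
      case False
      then have "j \<noteq> t" using t by auto
      then show ?thesis using y wx[OF that] that by (auto simp: agree_def)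
    qed
    then show "y \<in> vinterval m A w" using y by (auto simp: vinterval_def)
  qed
  then have "prob {y\<in>G. y \<in> vinterval m N z \<and> agree t A x y} \<le> prob (vinterval m A w)"
    by (intro finite_measure_mono) auto
  ultimately show ?thesis using prob_vinterval[OF w(1)] by simp
qed

text \<open>For \<open>n \<le> vbase m N\<close> the kernel is constant on the interval and the mean
  value 0 annihilates the integral. For larger \<open>n\<close>, blocks of rank at most
  \<open>N\<close> are constant on the interval, while each higher rank contributes at most
  \<open>H * w N\<close>.\<close>

lemma norm_conv_atom_le:
  assumes x: "x \<in> G" and z: "z \<in> G" and xz: "x \<notin> vinterval m N z"
    and a: "cylindrical L a" and aH: "\<And>y. y \<in> G \<Longrightarrow> norm (a y) \<le> H" 
    and supp: "\<And>y. y \<in> G \<Longrightarrow> y \<notin> vinterval m N z \<Longrightarrow> a y = 0"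
    and mean: "N > 0 \<Longrightarrow> (\<integral>y. a y \<partial>vilenkin m) = 0"
  shows "norm (conv n a x) \<le> 6 * B^3 * H / (M N)\<^sup>2 * (\<Sum>A\<le>N. \<Sum>t\<le>A. M A * M t * of_bool (agree t A z x)) * n"
proof -
  define w where "w A = (\<Sum>t\<le>A. M t * of_bool (agree t A z x))" for A
  have w_nonneg: "w A \<ge> 0" for A unfolding w_def by (intro sum_nonneg) auto
  have W: "(\<Sum>A\<le>N. \<Sum>t\<le>A. M A * M t * of_bool (agree t A z x)) = (\<Sum>A\<le>N. M A * w A)"
    by (simp only: w_def sum_distrib_left mult.assoc)
  have H: "H \<ge> 0" using aH[OF x] norm_ge_zero order_trans by blast
  have N: "N > 0" using x z xz by (cases N) (auto simp: vinterval_def)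
  show ?thesis
  proof (cases "n \<le> vbase m N")
    case True
    have "conv n a x = (\<integral>y. a y * fejer n x z \<partial>vilenkin m)"
      unfolding conv_def
    proof (intro Bochner_Integration.integral_cong refl)
      fix y assume "y \<in> G"
      then show "a y * fejer n x y = a y * fejer n x z"
        using supp[of y] cylindricalD[OF cylindrical_fejer[OF True, of x] z, of y] by fastforce
    qed
    then have "conv n a x = 0" using mean[OF N] by simp
    then show ?thesis unfolding W using w_nonneg H B_ge_2 by (auto intro!: mult_nonneg_nonneg divide_nonneg_nonneg sum_nonneg)
  next
    case False
    let ?h = "\<lambda>y. H * of_bool (y \<in> vinterval m N z)"
    let ?I = "\<lambda>A. \<integral>y. ?h y * block A x y \<partial>vilenkin m"
    have pI: "prob {y\<in>G. y \<in> vinterval m N z} = 1 / M N"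
      using prob_vinterval[OF z, of N] by (simp add: vinterval_def)
    have low: "?I A \<le> H / M N * (M A * w A)" if "A \<le> N" for A
    proof -
      have "?I A = (\<integral>y. (H * M A * w A) * of_bool (y \<in> vinterval m N z) \<partial>vilenkin m)"
      proof (intro Bochner_Integration.integral_cong refl)
        fix y
        show "?h y * block A x y = (H * M A * w A) * of_bool (y \<in> vinterval m N z)"
        proof (cases "y \<in> vinterval m N z")
          case True
          have "agree t A x y \<longleftrightarrow> agree t A z x" for t
            using True that by (auto simp: agree_def vinterval_def)
          then show ?thesis by (simp add: block_def w_def True)
        qed simp
      qed
      also have "\<dots> = H / M N * (M A * w A)" by (simp add: integral_of_bool pI)
      finally show ?thesis by simp
    qed
    have high: "?I A \<le> H * w N" if "N < A" for A
    proof -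
      have int: "integrable (vilenkin m) (\<lambda>y. of_bool (y \<in> vinterval m N z \<and> agree t A x y) :: real)" for t
        by (rule cylindrical_integrable[of A])
           (use that in \<open>intro cylindrical_comp2[of A _ _ "\<lambda>a b. of_bool (a \<and> b)"] cylindrical_agree cylindrical_vinterval; simp\<close>)
      have "?I A = (\<integral>y. H * M A * (\<Sum>t\<le>A. M t * of_bool (y \<in> vinterval m N z \<and> agree t A x y)) \<partial>vilenkin m)"
        by (intro Bochner_Integration.integral_cong refl) (auto simp: block_def)
      also have "\<dots> = H * M A * (\<Sum>t\<le>A. M t * prob {y\<in>G. y \<in> vinterval m N z \<and> agree t A x y})"
        by (intro integral_sum_of_bool int)
      also have "\<dots> \<le> H * M A * (\<Sum>t\<le>A. M t * (of_bool (t < N \<and> agree t N z x) / M A))"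
        using H M_pos that by (intro mult_left_mono sum_mono prob_vinterval_agree_le x z xz) (auto simp: less_imp_le)
      also have "\<dots> = H * (\<Sum>t\<le>A. M t * of_bool (t < N \<and> agree t N z x))"
        using M_pos[of A] by (simp add: sum_distrib_left del: sum_mult_of_bool_eq sum_of_bool_mult_eq)
      also have "(\<Sum>t\<le>A. M t * of_bool (t < N \<and> agree t N z x)) = (\<Sum>t<N. M t * of_bool (agree t N z x))"
        using that by (intro sum.mono_neutral_cong_right) auto
      also have "\<dots> \<le> w N" unfolding w_def by (intro sum_mono2) auto
      finally show ?thesis using H by (simp add: mult_left_mono)
    qed
    have "norm (conv n a x) \<le> 3 * B^3 * (\<Sum>A | vbase m A \<le> n. ?I A)"
    proof (rule norm_conv_le_sum[OF x cylindrical_mono[OF a], of "max L N"])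
      show "cylindrical (max L N) ?h"
        by (intro cylindrical_comp[of _ _ "\<lambda>u. H * of_bool u"] cylindrical_vinterval) simp
      show "norm (a y) \<le> ?h y" if "y \<in> G" for y using aH[OF that] supp[OF that] by auto
    qed simp
    also have "(\<Sum>A | vbase m A \<le> n. ?I A) = (\<Sum>A | vbase m A \<le> n \<and> A \<le> N. ?I A) + (\<Sum>A | vbase m A \<le> n \<and> N < A. ?I A)"
      using finite_vbase_le[of n] by (subst sum.union_disjoint[symmetric]) (auto intro!: sum.cong)
    also have "\<dots> \<le> 2 * (H * n / (M N)\<^sup>2 * (\<Sum>A\<le>N. M A * w A))"
    proof -
      have Nn: "M N \<le> real n" using False by simp
      have "(\<Sum>A | vbase m A \<le> n \<and> A \<le> N. ?I A) \<le> (\<Sum>A | vbase m A \<le> n \<and> A \<le> N. H / M N * (M A * w A))"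
        by (intro sum_mono low) simp
      also have "\<dots> \<le> (\<Sum>A\<le>N. H / M N * (M A * w A))"
        using w_nonneg H by (intro sum_mono2) auto
      also have "\<dots> = H / M N * (\<Sum>A\<le>N. M A * w A)" by (simp add: sum_distrib_left)
      \<comment> \<open>The factor \<open>n / M N\<close>, at least 1 in this case, is inserted so
        that low and high ranks get the same bound.\<close>
      also have "\<dots> \<le> H * n / (M N)\<^sup>2 * (\<Sum>A\<le>N. M A * w A)"
      proof (intro mult_right_mono sum_nonneg mult_nonneg_nonneg w_nonneg)
        have "H * M N \<le> H * n" using Nn H by (intro mult_left_mono) auto
        then show "H / M N \<le> H * n / (M N)\<^sup>2"
          using M_pos[of N] by (simp add: divide_simps power2_eq_square)
      qed simp
      finally have 1: "(\<Sum>A | vbase m A \<le> n \<and> A \<le> N. ?I A) \<le> H * n / (M N)\<^sup>2 * (\<Sum>A\<le>N. M A * w A)" .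
      let ?S = "{A. vbase m A \<le> n \<and> N < A}"
      have finS: "finite ?S" using finite_vbase_le[of n] by (rule rev_finite_subset) auto
      \<comment> \<open>The number of these ranks is only logarithmic in \<open>n / M N\<close>, but
        the crude count \<open>n / M N\<close> suffices, the target being linear in
        \<open>n\<close>.\<close>
      have "real (card ?S) * M N = (\<Sum>A\<in>?S. M N)" by simp
      also have "\<dots> \<le> (\<Sum>A\<in>?S. M A / 2)"
      proof (intro sum_mono)
        fix A assume "A \<in> ?S"
        then have "M (Suc N) \<le> M A" by (intro M_mono) auto
        then show "M N \<le> M A / 2" using M_Suc_ge[of N] by linarith
      qed
      also have "\<dots> = (\<Sum>A\<in>?S. M A) / 2" by (simp add: sum_divide_distrib)
      also have "\<dots> \<le> (2 * real n) / 2" using finS by (intro divide_right_mono sum_M_le) auto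
      finally have card: "real (card ?S) * M N \<le> n" by simp
      have "(\<Sum>A\<in>?S. ?I A) \<le> (\<Sum>A\<in>?S. H * w N)" by (intro sum_mono high) simp
      also have "\<dots> = real (card ?S) * (H * w N)" by simp
      also have "\<dots> \<le> (n / M N) * (H * w N)"
        using card H w_nonneg M_pos[of N] by (intro mult_right_mono) (auto simp: le_divide_eq)
      also have "\<dots> = H * n / (M N)\<^sup>2 * (M N * w N)" using M_pos[of N] by (simp add: power2_eq_square)
      also have "\<dots> \<le> H * n / (M N)\<^sup>2 * (\<Sum>A\<le>N. M A * w A)"
        using H w_nonneg by (intro mult_left_mono member_le_sum[of N "{..N}" "\<lambda>A. M A * w A"]) auto
      finally have 2: "(\<Sum>A\<in>?S. ?I A) \<le> H * n / (M N)\<^sup>2 * (\<Sum>A\<le>N. M A * w A)" .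
      show ?thesis unfolding mult_2 by (rule add_mono[OF 1 2])
    qed
    finally have "norm (conv n a x) \<le> 3 * B^3 * (2 * (H * n / (M N)\<^sup>2 * (\<Sum>A\<le>N. M A * w A)))"
      using B_ge_2 by (simp add: mult_left_mono)
    then show ?thesis unfolding W by (simp add: mult_ac)
  qed
qed

end

section \<open>Martingales and Fejer means\<close>

lemma sum_divide_index_by_parts:
  fixes s :: "nat \<Rightarrow> complex"
  shows "(\<Sum>k=1..n. s k / of_nat k) =
    (\<Sum>j=1..n. s j) / of_nat n + (\<Sum>k=1..<n. (\<Sum>j=1..k. s j) / of_nat (k * Suc k))"
proof (induction n)
  case (Suc n)
  show ?case
  proof (cases "n = 0")
    case False
    have *: "P / v = P / (1 + v) + P / (v * (1 + v))" if "v \<noteq> 0" "1 + v \<noteq> 0" for P v :: complex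
      using that by (simp add: divide_simps) (simp add: algebra_simps)
    let ?P = "\<Sum>j=1..n. s j"
    have "?P / of_nat n = ?P / of_nat (Suc n) + ?P / of_nat (n * Suc n)"
      using *[of "of_nat n" ?P] False of_nat_neq_0[of n, where 'a=complex] unfolding of_nat_mult of_nat_Suc by simp
    moreover have "{1..<Suc n} = insert n {1..<n}" using False by auto
    ultimately show ?thesis using Suc.IH by (simp add: add_divide_distrib del: of_nat_mult)
  qed simp
qed simp

lemma harm_shift:
  assumes "n \<ge> 1"
  shows "harm n = 1 + (\<Sum>k=1..<n. 1 / real (Suc k))"
  using assms
proof (induction n rule: dec_induct)
  case (step n)
  then have "{1..<Suc n} = insert n {1..<n}" by auto
  with step show ?case by (simp add: harm_Suc divide_inverse del: of_nat_Suc)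
qed (simp add: harm_def)

text \<open>After summation by parts the weights of the Fejer means add up to \<open>harm n\<close>
  by \<open>harm_shift\<close>, so the passage to Riesz means costs no constant.\<close>

lemma norm_riesz_mean_le:
  assumes n: "n \<ge> 1" and "lam \<ge> 0"
    and le: "\<And>k. 1 \<le> k \<Longrightarrow> k \<le> n \<Longrightarrow> norm (\<Sum>j=1..k. vpartial_sum m f j x) \<le> lam * real k"
  shows "norm (riesz_mean m f n x) \<le> lam"
proof -
  let ?F = "\<lambda>k. \<Sum>j=1..k. vpartial_sum m f j x"
  have "norm (\<Sum>k=1..n. vpartial_sum m f k x / of_nat k) \<le>
      norm (?F n / of_nat n) + norm (\<Sum>k=1..<n. ?F k / of_nat (k * Suc k))"
    unfolding sum_divide_index_by_parts[of "\<lambda>j. vpartial_sum m f j x"] by (rule norm_triangle_ineq)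
  also have "\<dots> \<le> lam + (\<Sum>k=1..<n. lam * (1 / real (Suc k)))"
  proof (intro add_mono sum_norm_le)
    show "norm (?F n / of_nat n) \<le> lam"
      using le[of n] n by (simp add: norm_divide divide_le_eq)
    fix k assume "k \<in> {1..<n}"
    then have k: "1 \<le> k" "k \<le> n" by auto
    have "norm (?F k / of_nat (k * Suc k)) = norm (?F k) / (real k * real (Suc k))"
      by (simp only: norm_divide norm_mult norm_of_nat of_nat_mult)
    also have "\<dots> \<le> lam * real k / (real k * real (Suc k))"
      using le[OF k] by (intro divide_right_mono) auto
    also have "\<dots> = lam * (1 / real (Suc k))" using k by (simp del: of_nat_Suc)
    finally show "norm (?F k / of_nat (k * Suc k)) \<le> lam * (1 / real (Suc k))" .
  qed
  also have "\<dots> = lam * harm n"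
    unfolding harm_shift[OF n] by (simp only: distrib_left sum_distrib_left mult_1_right)
  finally have *: "norm (\<Sum>k=1..n. vpartial_sum m f k x / of_nat k) \<le> lam * harm n" .
  have h: "harm n > (0::real)" using n by (intro harm_pos) auto
  \<comment> \<open>In \<open>riesz_mean\<close> the harmonic number is complex; its modulus is that
    of the positive real one.\<close>
  have "harm n = complex_of_real (harm n)" by (simp add: harm_def)
  then have "norm (riesz_mean m f n x) = norm (\<Sum>k=1..n. vpartial_sum m f k x / of_nat k) / harm n"
    using h unfolding riesz_mean_def by (simp add: norm_mult norm_divide)
  then show ?thesis using * h by (simp add: divide_le_eq)
qed

context bounded_vilenkin
begin

section \<open>Fourier coefficients of martingales\<close>

lemma vmartingale_cylindrical: "vmartingale m f \<Longrightarrow> cylindrical n (f n)"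
  by (rule vfilt_cylindrical) (auto simp: vmartingale_def)

text \<open>\<open>complex_cond_exp\<close> is assembled from real conditional expectations, so the
  averaging identity is obtained for real and imaginary parts and recombined.\<close>

lemma vmartingale_integral_vinterval:
  assumes f: "vmartingale m f" and x: "x \<in> G" and "n \<le> k"
  shows "(\<integral>y. of_bool (y \<in> vinterval m n x) * f k y \<partial>vilenkin m) = (\<integral>y. of_bool (y \<in> vinterval m n x) * f n y \<partial>vilenkin m)"
proof -
  interpret F: finite_measure_subalgebra "vilenkin m" "vfilt m n"
    by unfold_locales (rule subalgebra_vfilt)
  let ?I = "vinterval m n x"
  have int: "integrable (vilenkin m) (f j)" for j using f by (auto simp: vmartingale_def)
  have AE: "AE y in vilenkin m. complex_cond_exp (vilenkin m) (vfilt m n) (f k) y = f n y"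
    using f assms(3) by (auto simp: vmartingale_def)
  have *: "(\<integral>y. indicat_real ?I y * g (f k y) \<partial>vilenkin m) = (\<integral>y. indicat_real ?I y * g (f n y) \<partial>vilenkin m)"
    if g: "g = Re \<or> g = Im" for g
  proof -
    have [measurable]: "f n \<in> borel_measurable (vilenkin m)" using int by auto
    have [measurable]: "g \<in> borel_measurable borel" using g by auto
    have gint: "integrable (vilenkin m) (\<lambda>y. g (f k y))" using g int by auto
    have "(\<integral>y. indicat_real ?I y * g (f k y) \<partial>vilenkin m) =
        (\<integral>y. indicat_real ?I y * real_cond_exp (vilenkin m) (vfilt m n) (\<lambda>y. g (f k y)) y \<partial>vilenkin m)"
      using F.real_cond_exp_intA[OF gint vinterval_in_vfilt[OF x, of n]]
      by (simp add: set_lebesgue_integral_def)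
    also have "\<dots> = (\<integral>y. indicat_real ?I y * g (f n y) \<partial>vilenkin m)"
    proof (rule integral_cong_AE)
      show "AE y in vilenkin m. indicat_real ?I y * real_cond_exp (vilenkin m) (vfilt m n) (\<lambda>y. g (f k y)) y =
          indicat_real ?I y * g (f n y)"
        using AE
      proof eventually_elim
        case (elim y)
        from arg_cong[OF elim, of g] show ?case using g by (auto simp: complex_cond_exp_def)
      qed
    qed measurable
    finally show ?thesis .
  qed
  have int2: "integrable (vilenkin m) (\<lambda>y. of_bool (y \<in> ?I) * f j y)" for j
    using integrable_mult_indicator[OF sets_vinterval int, of n x j]
    by (simp add: indicator_def of_bool_def if_distrib[of "\<lambda>c. c *\<^sub>R _"] if_distrib[of "\<lambda>c. c * _"] cong: if_cong)
  have Re: "Re (\<integral>y. of_bool (y \<in> ?I) * f j y \<partial>vilenkin m) = (\<integral>y. indicat_real ?I y * Re (f j y) \<partial>vilenkin m)" for j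
    unfolding integral_Re[OF int2, symmetric] by (intro Bochner_Integration.integral_cong) (auto simp: indicator_def)
  have Im: "Im (\<integral>y. of_bool (y \<in> ?I) * f j y \<partial>vilenkin m) = (\<integral>y. indicat_real ?I y * Im (f j y) \<partial>vilenkin m)" for j
    unfolding integral_Im[OF int2, symmetric] by (intro Bochner_Integration.integral_cong) (auto simp: indicator_def)
  show ?thesis using *[of Re] *[of Im] by (intro complex_eqI) (simp_all only: Re Im simp_thms)
qed

text \<open>On \<open>G\<close>, \<open>g\<close> is a finite combination of indicators of rank
  \<open>n\<close> intervals.\<close>

lemma vmartingale_integral_mult:
  assumes f: "vmartingale m f" and g: "cylindrical n g" and "n \<le> k"
  shows "(\<integral>y. f k y * g y \<partial>vilenkin m) = (\<integral>y. f n y * g y \<partial>vilenkin m)"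
proof -
  have expand: "(\<integral>y. f j y * g y \<partial>vilenkin m) = (\<Sum>z\<in>reps n. g z * (\<integral>y. of_bool (y \<in> vinterval m n z) * f j y \<partial>vilenkin m))" for j
  proof -
    have int: "integrable (vilenkin m) (\<lambda>y. of_bool (y \<in> vinterval m n z) * f j y)" for z
      by (rule cylindrical_integrable[of "max n j"])
         (intro cylindrical_comp2[of _ _ _ "\<lambda>a b. of_bool a * b"] cylindrical_vinterval cylindrical_mono[OF vmartingale_cylindrical[OF f]]; simp)
    have "(\<integral>y. f j y * g y \<partial>vilenkin m) = (\<integral>y. (\<Sum>z\<in>reps n. g z * (of_bool (y \<in> vinterval m n z) * f j y)) \<partial>vilenkin m)"
    proof (intro Bochner_Integration.integral_cong refl)
      fix y assume y: "y \<in> G"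
      have "(\<Sum>z\<in>reps n. g z * (of_bool (y \<in> vinterval m n z) * f j y)) =
          (\<Sum>z\<in>reps n. if y \<in> vinterval m n z then g z * f j y else 0)"
        by (intro sum.cong) auto
      also have "\<dots> = f j y * g y"
        unfolding sum_reps[OF y] cylindrical_rep[OF g y] by (rule mult.commute)
      finally show "f j y * g y = (\<Sum>z\<in>reps n. g z * (of_bool (y \<in> vinterval m n z) * f j y))" ..
    qed
    also have "\<dots> = (\<Sum>z\<in>reps n. \<integral>y. g z * (of_bool (y \<in> vinterval m n z) * f j y) \<partial>vilenkin m)"
      using int by (intro Bochner_Integration.integral_sum integrable_mult_right) 
    finally show ?thesis by simp
  qed
  show ?thesis unfolding expand
    using vmartingale_integral_vinterval[OF f reps_in_G assms(3)] by (intro sum.cong) auto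
qed

text \<open>\<open>vpsi m i\<close> depends on the first \<open>L\<close> coordinates only, so the
  sequence under the limit is constant from \<open>L\<close> on.\<close>

lemma vcoeff_eq:
  assumes f: "vmartingale m f" and i: "i < vbase m L"
  shows "vcoeff m f i = (\<integral>y. f L y * cnj (vpsi m i y) \<partial>vilenkin m)"
  unfolding vcoeff_def
proof (rule limI, rule tendsto_eventually)
  show "\<forall>\<^sub>F k in sequentially. (\<integral>y. f k y * cnj (vpsi m i y) \<partial>vilenkin m) = (\<integral>y. f L y * cnj (vpsi m i y) \<partial>vilenkin m)"
    using eventually_ge_at_top[of L]
    by eventually_elim (intro vmartingale_integral_mult f cylindrical_comp[of L _ cnj] cylindrical_vpsi i)
qed

lemma sum_vpartial_sum:
  assumes f: "vmartingale m f" and n: "n \<le> vbase m L"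
  shows "(\<Sum>k=1..n. vpartial_sum m f k x) = conv n (f L) x"
proof -
  have int: "integrable (vilenkin m) (\<lambda>y. f L y * (vpsi m j x * cnj (vpsi m j y)))" if "j < vbase m L" for j
    by (rule cylindrical_integrable[of L])
       (intro cylindrical_comp2[of _ _ _ "\<lambda>a b. a * (vpsi m j x * cnj b)"] vmartingale_cylindrical f cylindrical_vpsi that)
  have "vpartial_sum m f k x = (\<integral>y. f L y * dirichlet k x y \<partial>vilenkin m)
      \<and> integrable (vilenkin m) (\<lambda>y. f L y * dirichlet k x y)" if "k \<le> n" for k
  proof
    show "integrable (vilenkin m) (\<lambda>y. f L y * dirichlet k x y)"
      unfolding dirichlet_def sum_distrib_left using that n by (intro Bochner_Integration.integrable_sum int) auto
    have "vpartial_sum m f k x = (\<Sum>j<k. \<integral>y. f L y * (vpsi m j x * cnj (vpsi m j y)) \<partial>vilenkin m)"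
      unfolding vpartial_sum_def
    proof (intro sum.cong refl)
      fix j assume "j \<in> {..<k}"
      then have j: "j < vbase m L" using that n by auto
      have "vcoeff m f j * vpsi m j x = (\<integral>y. f L y * cnj (vpsi m j y) * vpsi m j x \<partial>vilenkin m)"
        unfolding vcoeff_eq[OF f j] by (rule integral_mult_left_zero[symmetric])
      then show "vcoeff m f j * vpsi m j x = (\<integral>y. f L y * (vpsi m j x * cnj (vpsi m j y)) \<partial>vilenkin m)"
        by (simp add: mult_ac)
    qed
    also have "\<dots> = (\<integral>y. (\<Sum>j<k. f L y * (vpsi m j x * cnj (vpsi m j y))) \<partial>vilenkin m)"
      using that n by (intro Bochner_Integration.integral_sum[symmetric] int) auto
    finally show "vpartial_sum m f k x = (\<integral>y. f L y * dirichlet k x y \<partial>vilenkin m)"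
      unfolding dirichlet_def sum_distrib_left .
  qed
  then have "(\<Sum>k=1..n. vpartial_sum m f k x) = (\<integral>y. (\<Sum>k=1..n. f L y * dirichlet k x y) \<partial>vilenkin m)"
    by (subst Bochner_Integration.integral_sum) auto
  then show ?thesis unfolding conv_def fejer_def sum_distrib_left .
qed

end

section \<open>Stopping\<close>

context bounded_vilenkin
begin

declare sum_mult_of_bool_eq [simp del] sum_of_bool_mult_eq [simp del]

lemma cylindrical_sets:
  assumes "cylindrical n Q"
  shows "{x\<in>G. Q x} \<in> sets (vilenkin m)"
proof -
  have "(\<lambda>x. of_bool (Q x) :: real) -` {1} \<inter> G \<in> sets (vilenkin m)"
    using cylindrical_measurable[OF cylindrical_comp[OF assms, of of_bool]] by (rule measurable_sets) simp
  moreover have "(\<lambda>x. of_bool (Q x) :: real) -` {1} \<inter> G = {x\<in>G. Q x}" by auto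
  ultimately show ?thesis by simp
qed

text \<open>\<open>good f \<alpha> n x\<close> says that the stopping time at height \<open>\<alpha>\<close> exceeds \<open>n\<close>. Looking one step ahead
  makes the stopped martingale bounded by \<open>\<alpha>\<close>; boundedness of \<open>m\<close> pays for it in
  \<open>sum_cells_le\<close>.\<close>

definition good :: "(nat \<Rightarrow> (nat \<Rightarrow> nat) \<Rightarrow> complex) \<Rightarrow> real \<Rightarrow> nat \<Rightarrow> (nat \<Rightarrow> nat) \<Rightarrow> bool" where
  "good f \<alpha> n x \<longleftrightarrow> (\<forall>i\<le>n. \<forall>y\<in>vinterval m i x. norm (f i y) \<le> \<alpha> \<and> norm (f (Suc i) y) \<le> \<alpha>)"

text \<open>The value \<open>0\<close> at stopping time \<open>0\<close> keeps the bound by \<open>\<alpha>\<close>. The resulting atoms need not have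
  integral \<open>0\<close>, which is harmless because no point lies off their interval, the whole group.\<close>

definition stopped :: "(nat \<Rightarrow> (nat \<Rightarrow> nat) \<Rightarrow> complex) \<Rightarrow> real \<Rightarrow> nat \<Rightarrow> (nat \<Rightarrow> nat) \<Rightarrow> complex" where
  "stopped f \<alpha> L x = f 0 x * of_bool (good f \<alpha> 0 x) + (\<Sum>n<L. (f (Suc n) x - f n x) * of_bool (good f \<alpha> n x))"

definition stops :: "(nat \<Rightarrow> (nat \<Rightarrow> nat) \<Rightarrow> complex) \<Rightarrow> real \<Rightarrow> nat \<Rightarrow> (nat \<Rightarrow> nat) \<Rightarrow> bool" where
  "stops f \<alpha> N x \<longleftrightarrow> \<not> good f \<alpha> N x \<and> (\<forall>i<N. good f \<alpha> i x)"

text \<open>Encoding an interval by its rank and canonical representative keeps the index set finite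
  and free of repetitions.\<close>

definition cells :: "(nat \<Rightarrow> (nat \<Rightarrow> nat) \<Rightarrow> complex) \<Rightarrow> real \<Rightarrow> nat \<Rightarrow> (nat \<times> (nat \<Rightarrow> nat)) set" where
  "cells f \<alpha> L = (SIGMA N:{..L}. {z \<in> reps N. stops f \<alpha> N z})"

lemma good_antimono: "good f \<alpha> n x \<Longrightarrow> k \<le> n \<Longrightarrow> good f \<alpha> k x"
  by (simp add: good_def)

lemma good_mono: "good f \<alpha> n x \<Longrightarrow> \<alpha> \<le> \<beta> \<Longrightarrow> good f \<beta> n x"
  by (fastforce simp: good_def)

lemma cylindrical_good: "cylindrical n (good f \<alpha> n)"
proof (rule cylindricalI)
  fix x y :: "nat \<Rightarrow> nat" assume "\<And>j. j < n \<Longrightarrow> x j = y j"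
  then have "vinterval m i x = vinterval m i y" if "i \<le> n" for i
    using that by (auto simp: vinterval_def)
  then show "good f \<alpha> n x = good f \<alpha> n y" by (simp add: good_def)
qed

lemma cylindrical_stops: "cylindrical N (stops f \<alpha> N)"
proof (rule cylindricalI)
  fix x y assume xy: "x \<in> G" "y \<in> G" "\<And>j. j < N \<Longrightarrow> x j = y j"
  have "good f \<alpha> i x = good f \<alpha> i y" if "i \<le> N" for i
    using xy that by (intro cylindrical_eq[OF cylindrical_good]) auto
  then show "stops f \<alpha> N x = stops f \<alpha> N y" by (simp add: stops_def)
qed

lemma finite_cells: "finite (cells f \<alpha> L)"
  unfolding cells_def using finite_reps by auto

lemma in_vinterval_self: "x \<in> G \<Longrightarrow> x \<in> vinterval m n x"
  by (simp add: vinterval_def)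

lemma stopped_eq:
  assumes "good f \<alpha> L x"
  shows "stopped f \<alpha> L x = f L x"
proof -
  have "good f \<alpha> n x" if "n \<le> L" for n using good_antimono[OF assms that] .
  then have "stopped f \<alpha> L x = f 0 x + (\<Sum>n<L. f (Suc n) x - f n x)"
    by (simp add: stopped_def)
  then show ?thesis using sum_lessThan_telescope[of "\<lambda>n. f n x" L] by simp
qed

text \<open>While the point is good at \<open>L\<close>, the sum telescopes to
  \<open>f (Suc L) x\<close>, which the look-ahead bounds; once it is not, the value is
  frozen.\<close>

lemma norm_stopped_le:
  assumes "x \<in> G" "\<alpha> \<ge> 0"
  shows "norm (stopped f \<alpha> L x) \<le> \<alpha>"
proof (induction L)
  case 0
  then show ?case using assms in_vinterval_self[of x 0] by (auto simp: stopped_def good_def)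
next
  case (Suc L)
  have step: "stopped f \<alpha> (Suc L) x = stopped f \<alpha> L x + (f (Suc L) x - f L x) * of_bool (good f \<alpha> L x)"
    by (simp add: stopped_def)
  show ?case
  proof (cases "good f \<alpha> L x")
    case True
    then have "stopped f \<alpha> (Suc L) x = f (Suc L) x"
      using step stopped_eq[OF True] by simp
    then show ?thesis using True in_vinterval_self[OF assms(1), of L] by (auto simp: good_def)
  next
    case False
    then show ?thesis using Suc step by simp
  qed
qed

lemma cylindrical_stopped:
  assumes "vmartingale m f"
  shows "cylindrical L (stopped f \<alpha> L)"
proof -
  have "cylindrical L (f n)" "cylindrical L (good f \<alpha> n)" if "n \<le> L" for n
    using that by (auto intro: cylindrical_mono[OF vmartingale_cylindrical[OF assms]] cylindrical_mono[OF cylindrical_good])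
  then show ?thesis
    unfolding stopped_def
    by (intro cylindrical_comp2[of _ _ _ "(+)"] cylindrical_comp2[of _ _ _ "(-)"]
      cylindrical_comp2[of _ _ _ "\<lambda>a b. a * of_bool b"] cylindrical_sum) auto
qed

text \<open>Increments before \<open>N\<close> are all kept and telescope to \<open>f N\<close>;
  each later one is multiplied by a factor known at its time and integrates to 0. As the right side
  does not involve the height, differences between two heights will have mean value 0.\<close>

lemma integral_stopped_vinterval:
  assumes f: "vmartingale m f" and z: "z \<in> G" and N: "0 < N" "N \<le> L" and good: "\<And>i. i < N \<Longrightarrow> good f \<alpha> i z"
  shows "(\<integral>y. stopped f \<alpha> L y * of_bool (y \<in> vinterval m N z) \<partial>vilenkin m) = (\<integral>y. f N y * of_bool (y \<in> vinterval m N z) \<partial>vilenkin m)"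
proof -
  let ?I = "vinterval m N z"
  let ?h = "\<lambda>n y. (f (Suc n) y - f n y) * of_bool (good f \<alpha> n y \<and> y \<in> ?I)"
  have cyl: "cylindrical n (\<lambda>y. of_bool (good f \<alpha> n y \<and> y \<in> ?I) :: complex)" if "N \<le> n" for n
    using that by (intro cylindrical_comp2[of _ _ _ "\<lambda>a b. of_bool (a \<and> b)"] cylindrical_good cylindrical_vinterval)
  have cylf: "cylindrical k (f n)" if "n \<le> k" for n k
    using that by (rule cylindrical_mono[OF vmartingale_cylindrical[OF f]])
  have intf: "integrable (vilenkin m) (\<lambda>y. f k y * of_bool (good f \<alpha> n y \<and> y \<in> ?I))" if "N \<le> n" for k n
    by (rule cylindrical_integrable[of "max k n"])
       (intro cylindrical_comp2[of _ _ _ "(*)"] cylindrical_mono[OF cyl[OF that]] cylf; simp)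
  have int: "integrable (vilenkin m) (?h n)" if "N \<le> n" for n
    unfolding left_diff_distrib by (rule Bochner_Integration.integrable_diff[OF intf[OF that] intf[OF that]])
  have zero: "(\<integral>y. ?h n y \<partial>vilenkin m) = 0" if "N \<le> n" for n
    unfolding left_diff_distrib Bochner_Integration.integral_diff[OF intf[OF that] intf[OF that]]
    using vmartingale_integral_mult[OF f cyl[OF that], of "Suc n"] by (simp del: of_bool_conj)
  have "(\<integral>y. stopped f \<alpha> L y * of_bool (y \<in> ?I) \<partial>vilenkin m) =
      (\<integral>y. f N y * of_bool (y \<in> ?I) + (\<Sum>n\<in>{N..<L}. ?h n y) \<partial>vilenkin m)"
  proof (intro Bochner_Integration.integral_cong refl)
    fix y assume y: "y \<in> G"
    show "stopped f \<alpha> L y * of_bool (y \<in> ?I) = f N y * of_bool (y \<in> ?I) + (\<Sum>n\<in>{N..<L}. ?h n y)"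
    proof (cases "y \<in> ?I")
      case True
      have good': "good f \<alpha> n y" if "n < N" for n
      proof -
        have "y \<in> vinterval m n z" using True that by (auto simp: vinterval_def)
        then show ?thesis using cylindricalD[OF cylindrical_good z] good[OF that] by blast
      qed
      have "{..<L} = {..<N} \<union> {N..<L}" using N by auto
      then have "stopped f \<alpha> L y = f 0 y * of_bool (good f \<alpha> 0 y) + ((\<Sum>n<N. (f (Suc n) y - f n y) * of_bool (good f \<alpha> n y)) +
          (\<Sum>n\<in>{N..<L}. (f (Suc n) y - f n y) * of_bool (good f \<alpha> n y)))"
        unfolding stopped_def by (simp only: sum.union_disjoint[of "{..<N}" "{N..<L}"] finite_lessThan finite_atLeastLessThan
          ivl_disj_int)
      also have "(\<Sum>n<N. (f (Suc n) y - f n y) * of_bool (good f \<alpha> n y)) = (\<Sum>n<N. f (Suc n) y - f n y)"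
        using good' by (intro sum.cong) auto
      also have "\<dots> = f N y - f 0 y" by (rule sum_lessThan_telescope[of "\<lambda>n. f n y" N])
      finally show ?thesis using True good'[of 0] N(1) by simp
    qed simp
  qed
  also have "\<dots> = (\<integral>y. f N y * of_bool (y \<in> ?I) \<partial>vilenkin m) + (\<integral>y. (\<Sum>n\<in>{N..<L}. ?h n y) \<partial>vilenkin m)"
  proof (rule Bochner_Integration.integral_add)
    show "integrable (vilenkin m) (\<lambda>y. f N y * of_bool (y \<in> ?I))"
      by (rule cylindrical_integrable[of N])
         (intro cylindrical_comp2[of _ _ _ "\<lambda>a b. a * of_bool b"] cylindrical_vinterval cylf order_refl)
    show "integrable (vilenkin m) (\<lambda>y. \<Sum>n\<in>{N..<L}. ?h n y)"
      by (intro Bochner_Integration.integrable_sum int) simp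
  qed
  also have "(\<integral>y. (\<Sum>n\<in>{N..<L}. ?h n y) \<partial>vilenkin m) = (\<Sum>n\<in>{N..<L}. \<integral>y. ?h n y \<partial>vilenkin m)"
    by (intro Bochner_Integration.integral_sum int) simp
  also have "\<dots> = 0" using zero by (intro sum.neutral) simp
  finally show ?thesis by simp
qed

section \<open>Partition into cells and their measure\<close>

lemma cellsD:
  assumes "(N, z) \<in> cells f \<alpha> L"
  shows "N \<le> L" "z \<in> G" "stops f \<alpha> N z"
  using assms reps_in_G[of z N] by (simp_all add: cells_def)

lemma not_good_in_cell:
  assumes "(N, z) \<in> cells f \<alpha> L" "y \<in> vinterval m N z"
  shows "\<not> good f \<alpha> L y"
proof
  assume "good f \<alpha> L y"
  then have "good f \<alpha> N y" using cellsD(1)[OF assms(1)] by (rule good_antimono)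
  then have "good f \<alpha> N z"
    unfolding cylindricalD[OF cylindrical_good cellsD(2)[OF assms(1)] assms(2)] .
  then show False using cellsD(3)[OF assms(1)] by (simp add: stops_def)
qed

text \<open>A point that is not good has a unique first failure time, hence lies in exactly one
  cell. The coefficient \<open>c\<close> allows both indicators and differences of stopped
  martingales to be split over cells.\<close>

lemma sum_cells:
  fixes c :: "'b::semiring_1"
  assumes x: "x \<in> G" and zero: "good f \<alpha> L x \<Longrightarrow> c = 0"
  shows "(\<Sum>(N, z)\<in>cells f \<alpha> L. c * of_bool (x \<in> vinterval m N z)) = c"
proof -
  have "(\<Sum>(N, z)\<in>cells f \<alpha> L. c * of_bool (x \<in> vinterval m N z)) =
      (\<Sum>N\<le>L. \<Sum>z\<in>{z \<in> reps N. stops f \<alpha> N z}. c * of_bool (x \<in> vinterval m N z))"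
    unfolding cells_def using finite_reps by (subst sum.Sigma) auto
  also have "\<dots> = (\<Sum>N\<le>L. if stops f \<alpha> N x then c else 0)"
  proof (intro sum.cong refl)
    fix N
    have "(\<Sum>z\<in>{z \<in> reps N. stops f \<alpha> N z}. c * of_bool (x \<in> vinterval m N z)) =
      (\<Sum>z\<in>reps N. if x \<in> vinterval m N z then (if stops f \<alpha> N z then c else 0) else 0)"
      unfolding sum.inter_filter[OF finite_reps] by (intro sum.cong) auto
    also have "\<dots> = (if stops f \<alpha> N x then c else 0)"
      unfolding sum_reps[OF x] cylindrical_rep[OF cylindrical_stops x] ..
    finally show "(\<Sum>z\<in>{z \<in> reps N. stops f \<alpha> N z}. c * of_bool (x \<in> vinterval m N z)) = (if stops f \<alpha> N x then c else 0)" .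
  qed
  also have "\<dots> = c"
  proof (cases "good f \<alpha> L x")
    case True
    show ?thesis unfolding zero[OF True] by (rule sum.neutral) auto
  next
    case False
    define K where "K = (LEAST N. \<not> good f \<alpha> N x)"
    have K: "\<not> good f \<alpha> K x" unfolding K_def using False by (rule LeastI)
    have "K \<le> L" unfolding K_def using False by (rule Least_le)
    have less: "good f \<alpha> i x" if "i < K" for i using that not_less_Least unfolding K_def by blast
    have "stops f \<alpha> N x \<longleftrightarrow> N = K" for N
    proof
      assume N: "stops f \<alpha> N x"
      show "N = K"
      proof (rule linorder_cases[of N K])
        assume "N < K" then show ?thesis using less N by (simp add: stops_def)
      next
        assume "K < N" then show ?thesis using K N by (simp add: stops_def)
      qed
    qed (use K less in \<open>simp add: stops_def\<close>)
    then show ?thesis using \<open>K \<le> L\<close> by simp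
  qed
  finally show ?thesis .
qed

lemma prob_vinterval_Int: "z \<in> G \<Longrightarrow> prob {y\<in>G. y \<in> vinterval m N z} = 1 / M N"
  using prob_vinterval[of z N] by (simp add: vinterval_def)

lemma integrable_of_bool_vinterval: "integrable (vilenkin m) (\<lambda>y. of_bool (y \<in> vinterval m N z) :: real)"
  by (rule cylindrical_integrable[of N]) (intro cylindrical_comp[of N _ of_bool] cylindrical_vinterval order_refl)

lemma prob_not_good:
  "prob {x\<in>G. \<not> good f \<alpha> L x} = (\<Sum>(N, z)\<in>cells f \<alpha> L. 1 / M N)"
proof -
  have "prob {x\<in>G. \<not> good f \<alpha> L x} = (\<integral>x. of_bool (\<not> good f \<alpha> L x) \<partial>vilenkin m)"
    by (rule integral_of_bool[symmetric])
  also have "\<dots> = (\<integral>x. (\<Sum>c\<in>cells f \<alpha> L. of_bool (x \<in> vinterval m (fst c) (snd c))) \<partial>vilenkin m)"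
  proof (intro Bochner_Integration.integral_cong refl)
    fix x assume x: "x \<in> G"
    have "(\<Sum>c\<in>cells f \<alpha> L. of_bool (x \<in> vinterval m (fst c) (snd c))) =
        (\<Sum>(N, z)\<in>cells f \<alpha> L. of_bool (\<not> good f \<alpha> L x) * of_bool (x \<in> vinterval m N z) :: real)"
      using not_good_in_cell by (intro sum.cong) auto
    also have "\<dots> = of_bool (\<not> good f \<alpha> L x)" by (rule sum_cells[OF x]) simp
    finally show "of_bool (\<not> good f \<alpha> L x) = (\<Sum>c\<in>cells f \<alpha> L. of_bool (x \<in> vinterval m (fst c) (snd c)) :: real)" ..
  qed
  also have "\<dots> = (\<Sum>c\<in>cells f \<alpha> L. prob {x\<in>G. x \<in> vinterval m (fst c) (snd c)})"
    using integrable_of_bool_vinterval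
    by (subst Bochner_Integration.integral_sum) (auto simp: integral_of_bool)
  also have "\<dots> = (\<Sum>(N, z)\<in>cells f \<alpha> L. 1 / M N)"
    by (intro sum.cong refl) (auto simp: prob_vinterval_Int cellsD(2))
  finally show ?thesis .
qed

text \<open>The range ends at \<open>Suc L\<close> because \<open>good f \<alpha> L\<close> looks
  one step past \<open>L\<close>.\<close>

definition exceed :: "(nat \<Rightarrow> (nat \<Rightarrow> nat) \<Rightarrow> complex) \<Rightarrow> real \<Rightarrow> nat \<Rightarrow> (nat \<Rightarrow> nat) \<Rightarrow> bool" where
  "exceed f \<alpha> L x \<longleftrightarrow> (\<exists>n\<le>Suc L. \<alpha> < norm (f n x))"

lemma cylindrical_exceed:
  assumes "vmartingale m f"
  shows "cylindrical (Suc L) (exceed f \<alpha> L)"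
proof (rule cylindricalI)
  fix x y assume xy: "x \<in> G" "y \<in> G" "\<And>j. j < Suc L \<Longrightarrow> x j = y j"
  have "f n x = f n y" if "n \<le> Suc L" for n
    using cylindrical_eq[OF vmartingale_cylindrical[OF assms, of n] xy(1,2)] xy(3) that by auto
  then show "exceed f \<alpha> L x = exceed f \<alpha> L y" by (auto simp: exceed_def)
qed

text \<open>A cell of rank \<open>N\<close> contains an interval of rank \<open>Suc N\<close> on
  which the height is exceeded, and this fills at least the fraction \<open>1 / B\<close> of the
  cell. Disjointness of the cells lets these pieces be added.\<close>

lemma sum_cells_le:
  assumes f: "vmartingale m f"
  shows "(\<Sum>(N, z)\<in>cells f \<alpha> L. 1 / M N) \<le> B * prob {x\<in>G. exceed f \<alpha> L x}"
proof -
  let ?Q = "\<lambda>c x. exceed f \<alpha> L x \<and> x \<in> vinterval m (fst c) (snd c)"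
  have cylQ: "cylindrical (max (Suc L) (fst c)) (?Q c)" for c
    by (intro cylindrical_comp2[of _ _ _ "(\<and>)"] cylindrical_mono[OF cylindrical_exceed[OF f]] cylindrical_vinterval; simp)
  have intQ: "integrable (vilenkin m) (\<lambda>x. of_bool (?Q c x) :: real)" for c
    by (rule cylindrical_integrable) (rule cylindrical_comp[OF cylQ])
  have setQ: "{x\<in>G. ?Q c x} \<in> sets (vilenkin m)" for c
    by (rule cylindrical_sets[OF cylQ])
  have cell: "1 / M (fst c) \<le> B * prob {x\<in>G. ?Q c x}" if c: "c \<in> cells f \<alpha> L" for c
  proof -
    obtain N z where c_eq: "c = (N, z)" by (cases c)
    have N: "N \<le> L" and z: "z \<in> G" and stop: "stops f \<alpha> N z"
      using cellsD[OF c[unfolded c_eq]] by auto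
    from stop obtain i y where i: "i \<le> N" and y: "y \<in> vinterval m i z" and large: "\<alpha> < norm (f i y) \<or> \<alpha> < norm (f (Suc i) y)"
      unfolding stops_def good_def not_le[symmetric] by blast
    \<comment> \<open>All earlier times are good, so the failure occurs at the rank of the cell
      itself.\<close>
    have "i = N"
    proof (rule ccontr)
      assume "i \<noteq> N"
      then have "good f \<alpha> i z" using i stop by (simp add: stops_def)
      then have "norm (f i y) \<le> \<alpha>" "norm (f (Suc i) y) \<le> \<alpha>" using y unfolding good_def by auto
      then show False using large by simp
    qed
    have yG: "y \<in> G" using y by (simp add: vinterval_def)
    have "vinterval m (Suc N) y \<subseteq> {x\<in>G. ?Q c x}"
    proof
      fix x assume x: "x \<in> vinterval m (Suc N) y"
      then have "x \<in> vinterval m N y" by (auto simp: vinterval_def)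
      then have "f N x = f N y" "f (Suc N) x = f (Suc N) y"
        using x cylindricalD[OF vmartingale_cylindrical[OF f] yG] by blast+
      then have "exceed f \<alpha> L x"
        using large N unfolding exceed_def \<open>i = N\<close> by (elim disjE) (auto intro: exI[of _ N] exI[of _ "Suc N"])
      moreover have "x \<in> vinterval m N z" using x y by (auto simp: vinterval_def \<open>i = N\<close>)
      ultimately show "x \<in> {x\<in>G. ?Q c x}" by (auto simp: c_eq vinterval_def)
    qed
    then have "1 / M (Suc N) \<le> prob {x\<in>G. ?Q c x}"
      unfolding prob_vinterval[OF yG, symmetric] using setQ by (rule finite_measure_mono)
    then have "B * (1 / M (Suc N)) \<le> B * prob {x\<in>G. ?Q c x}"
      using B_ge_2 by (intro mult_left_mono) auto
    moreover have "1 / M N \<le> B * (1 / M (Suc N))"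
      using M_Suc_le[of N] M_pos[of N] M_pos[of "Suc N"] by (simp add: divide_simps mult.commute del: vbase.simps)
    ultimately show ?thesis unfolding c_eq fst_conv by linarith
  qed
  have "(\<Sum>(N, z)\<in>cells f \<alpha> L. 1 / M N) \<le> (\<Sum>c\<in>cells f \<alpha> L. B * prob {x\<in>G. ?Q c x})"
    using cell by (intro sum_mono) (auto simp: split_beta)
  also have "\<dots> = B * (\<integral>x. (\<Sum>c\<in>cells f \<alpha> L. of_bool (?Q c x)) \<partial>vilenkin m)"
    using intQ by (subst Bochner_Integration.integral_sum) (simp_all add: integral_of_bool sum_distrib_left del: of_bool_conj)
  also have "(\<integral>x. (\<Sum>c\<in>cells f \<alpha> L. of_bool (?Q c x)) \<partial>vilenkin m) \<le> (\<integral>x. of_bool (exceed f \<alpha> L x) \<partial>vilenkin m :: real)"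
  proof (rule integral_mono)
    show "integrable (vilenkin m) (\<lambda>x. \<Sum>c\<in>cells f \<alpha> L. of_bool (?Q c x) :: real)"
      using intQ by (rule Bochner_Integration.integrable_sum)
    show "integrable (vilenkin m) (\<lambda>x. of_bool (exceed f \<alpha> L x) :: real)"
      by (rule cylindrical_integrable) (rule cylindrical_comp[OF cylindrical_exceed[OF f]])
    fix x assume x: "x \<in> G"
    have "(\<Sum>c\<in>cells f \<alpha> L. of_bool (?Q c x)) =
        of_bool (exceed f \<alpha> L x) * (\<Sum>(N, z)\<in>cells f \<alpha> L. of_bool (\<not> good f \<alpha> L x) * of_bool (x \<in> vinterval m N z) :: real)"
      unfolding sum_distrib_left using not_good_in_cell by (intro sum.cong) auto
    also have "\<dots> = of_bool (exceed f \<alpha> L x) * of_bool (\<not> good f \<alpha> L x)"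
      by (subst sum_cells[OF x]) simp_all
    finally show "(\<Sum>c\<in>cells f \<alpha> L. of_bool (?Q c x)) \<le> (of_bool (exceed f \<alpha> L x) :: real)" by simp
  qed
  also have "\<dots> = prob {x\<in>G. exceed f \<alpha> L x}" by (rule integral_of_bool)
  finally show ?thesis using B_ge_2 by (simp add: mult_left_mono)
qed

text \<open>Only finitely many terms of \<open>f\<close> matter and each is bounded, so finitely
  many heights will suffice in the decomposition.\<close>

lemma good_large:
  assumes "vmartingale m f"
  obtains \<beta> where "\<And>x. x \<in> G \<Longrightarrow> good f \<beta> L x"
proof -
  have "\<exists>K. \<forall>x\<in>G. norm (f n x) \<le> K" for n
    by (rule cylindrical_bounded[OF vmartingale_cylindrical[OF assms, of n]]) blast
  then obtain K where K': "\<forall>n. \<forall>x\<in>G. norm (f n x) \<le> K n" using choice[of "\<lambda>n K. \<forall>x\<in>G. norm (f n x) \<le> K"] by blast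
  then have K: "norm (f n x) \<le> K n" if "x \<in> G" for n x using that by blast
  have "norm (f n x) \<le> Max (K ` {..Suc L})" if "x \<in> G" "n \<le> Suc L" for n x
    using K[OF that(1), of n] that(2) by (intro order_trans[OF _ Max_ge]) auto
  then have "good f (Max (K ` {..Suc L})) L x" for x
    by (auto simp: good_def vinterval_def)
  then show ?thesis using that by blast
qed

end

section \<open>The weak type estimate\<close>

text \<open>A truncation at height \<open>\<lambda>\<close>: terms above \<open>\<lambda>\<close> are handled by the union bound, the others by
  Markov's inequality. Unlike a quasi-norm inequality this costs nothing in the number of terms.\<close>

lemma (in prob_space) prob_sum_gt_le:
  fixes c :: "'i \<Rightarrow> real"
  assumes J: "finite J" and c: "\<And>i. i \<in> J \<Longrightarrow> 0 \<le> c i" and l: "0 < l"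
    and Q: "\<And>i. i \<in> J \<Longrightarrow> {x\<in>space M. Q i x} \<in> events"
  shows "prob {x\<in>space M. l < (\<Sum>i\<in>J. c i * of_bool (Q i x))} \<le>
    (\<Sum>i\<in>J. if l < c i then prob {x\<in>space M. Q i x} else c i * prob {x\<in>space M. Q i x} / l)"
proof -
  let ?q = "\<lambda>i. {x\<in>space M. Q i x}"
  let ?A = "{i\<in>J. l < c i}" and ?B = "{i\<in>J. \<not> l < c i}"
  let ?Y = "\<lambda>x. \<Sum>i\<in>?B. c i * indicat_real (?q i) x"
  have int: "integrable M (indicat_real (?q i))" if "i \<in> J" for i
    using Q[OF that] by (intro integrable_real_indicator) (auto simp: emeasure_eq_measure)
  have intY: "integrable M ?Y"
    using int by (intro Bochner_Integration.integrable_sum integrable_mult_right) auto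
  have Y: "{x\<in>space M. l \<le> ?Y x} \<in> events"
    using borel_measurable_integrable[OF intY] by measurable
  have U: "(\<Union>i\<in>?A. ?q i) \<in> events" using J Q by (intro sets.finite_UN) auto
  have "{x\<in>space M. l < (\<Sum>i\<in>J. c i * of_bool (Q i x))} \<subseteq> (\<Union>i\<in>?A. ?q i) \<union> {x\<in>space M. l \<le> ?Y x}"
  proof
    fix x assume x: "x \<in> {x\<in>space M. l < (\<Sum>i\<in>J. c i * of_bool (Q i x))}"
    show "x \<in> (\<Union>i\<in>?A. ?q i) \<union> {x\<in>space M. l \<le> ?Y x}"
    proof (cases "x \<in> (\<Union>i\<in>?A. ?q i)")
      case False
      then have "(\<Sum>i\<in>J. c i * of_bool (Q i x)) = (\<Sum>i\<in>?B. c i * of_bool (Q i x))"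
        using J x by (intro sum.mono_neutral_right) auto
      also have "\<dots> = ?Y x" using x by (intro sum.cong) (auto simp: indicator_def)
      finally show ?thesis using x by simp
    qed simp
  qed
  then have "prob {x\<in>space M. l < (\<Sum>i\<in>J. c i * of_bool (Q i x))} \<le> prob ((\<Union>i\<in>?A. ?q i) \<union> {x\<in>space M. l \<le> ?Y x})"
    using U Y by (intro finite_measure_mono) auto
  also have "\<dots> \<le> prob (\<Union>i\<in>?A. ?q i) + prob {x\<in>space M. l \<le> ?Y x}"
    using U Y by (rule measure_Un_le)
  also have "prob (\<Union>i\<in>?A. ?q i) \<le> (\<Sum>i\<in>?A. prob (?q i))"
    using J Q by (intro finite_measure_subadditive_finite) auto
  also have "prob {x\<in>space M. l \<le> ?Y x} \<le> (\<integral>x. ?Y x \<partial>M) / l"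
    using l c by (intro integral_Markov_inequality_measure[where A="{}"] intY AE_I2 sum_nonneg) auto
  also have "(\<integral>x. ?Y x \<partial>M) = (\<Sum>i\<in>?B. c i * prob (?q i))"
  proof -
    have "(\<integral>x. ?Y x \<partial>M) = (\<Sum>i\<in>?B. \<integral>x. c i * indicat_real (?q i) x \<partial>M)"
      using int by (intro Bochner_Integration.integral_sum integrable_mult_right) auto
    also have "\<dots> = (\<Sum>i\<in>?B. c i * prob (?q i))"
    proof (intro sum.cong refl)
      fix i
      have "?q i \<inter> space M = ?q i" by auto
      then show "(\<integral>x. c i * indicat_real (?q i) x \<partial>M) = c i * prob (?q i)" by simp
    qed
    finally show ?thesis .
  qed
  also have "(\<Sum>i\<in>?A. prob (?q i)) + (\<Sum>i\<in>?B. c i * prob (?q i)) / l =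
      (\<Sum>i\<in>J. if l < c i then prob (?q i) else c i * prob (?q i) / l)"
    unfolding sum_divide_distrib by (rule sum.If_cases[OF J, symmetric, unfolded Int_def Compl_eq mem_Collect_eq])
  finally show ?thesis by simp
qed

text \<open>Heights, cells, ranks and positions become one index set, as
  \<open>prob_sum_gt_le\<close> expects.\<close>

lemma sum4_Sigma:
  assumes "finite I" "\<And>k. finite (P k)"
  shows "(\<Sum>k\<in>I. \<Sum>c\<in>P k. \<Sum>A\<le>(h c::nat). \<Sum>t\<le>A. F k c A t) =
    (\<Sum>i\<in>(SIGMA k:I. SIGMA c:P k. SIGMA A:{..h c}. {..A}). F (fst i) (fst (snd i)) (fst (snd (snd i))) (snd (snd (snd i))))"
  using assms by (simp add: sum.Sigma finite_SigmaI split_beta)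

text \<open>The largest index that occurs has \<open>2^k < sqrt (u / \<alpha>)\<close>, and adding
  all smaller powers less than doubles it.\<close>

lemma sum_powers_below_le:
  fixes u \<alpha> :: real
  assumes "\<alpha> > 0" "u \<ge> 0"
  shows "(\<Sum>k<K. 2^k * of_bool (\<alpha> * 4^k < u)) \<le> 2 * sqrt (u / \<alpha>)"
proof (induction K)
  case (Suc K)
  show ?case
  proof (cases "\<alpha> * 4^K < u")
    case True
    have "(\<Sum>k<Suc K. 2^k * of_bool (\<alpha> * 4^k < u)) \<le> (\<Sum>k<Suc K. (2::real)^k)"
      by (intro sum_mono) simp
    also have "\<dots> = 2 * 2^K - 1" by (induction K) auto
    also have "\<dots> \<le> 2 * sqrt (u / \<alpha>)"
    proof -
      have "((2::real)^K)\<^sup>2 = 4^K" by (simp add: power2_eq_square flip: power_mult_distrib)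
      also have "\<dots> \<le> u / \<alpha>" using True assms by (simp add: field_simps)
      finally have "2^K \<le> sqrt (u / \<alpha>)" by (rule real_le_rsqrt)
      then show ?thesis by simp
    qed
    finally show ?thesis .
  next
    case False
    then show ?thesis using Suc by simp
  qed
qed (use assms in simp)

context bounded_vilenkin
begin

text \<open>Comparing a coefficient with \<open>l\<close> means comparing \<open>M A * M t\<close>
  with \<open>y\<^sup>2\<close>. The union bound terms then form \<open>double_sum_large\<close>,
  the Markov terms \<open>double_sum_small\<close>, each contributing
  \<open>8 * B / y\<close>.\<close>

lemma cell_tail_sum:
  assumes z: "z \<in> G" and D: "D > 0" and l: "l > 0" and y: "y > 0" and lD: "l = D * y\<^sup>2"
  shows "(\<Sum>A\<le>N. \<Sum>t\<le>A. if l < D * (M A * M t) then prob {x\<in>G. agree t A z x}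
      else D * (M A * M t) * prob {x\<in>G. agree t A z x} / l) \<le> 16 * B / y"
proof -
  have "(\<Sum>A\<le>N. \<Sum>t\<le>A. if l < D * (M A * M t) then prob {x\<in>G. agree t A z x}
      else D * (M A * M t) * prob {x\<in>G. agree t A z x} / l) \<le>
    (\<Sum>A\<le>N. \<Sum>t\<le>A. B * (if M A * M t > y\<^sup>2 then 1 / M A else 0) + B / y\<^sup>2 * (if M A * M t \<le> y\<^sup>2 then M t else 0))"
  proof (intro sum_mono)
    fix A t :: nat
    let ?p = "prob {x\<in>G. agree t A z x}"
    have p: "?p \<le> B / M A" by (rule prob_agree_le[OF z])
    have iff: "l < D * (M A * M t) \<longleftrightarrow> M A * M t > y\<^sup>2" unfolding lD using D by simp
    show "(if l < D * (M A * M t) then ?p else D * (M A * M t) * ?p / l) \<le>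
      B * (if M A * M t > y\<^sup>2 then 1 / M A else 0) + B / y\<^sup>2 * (if M A * M t \<le> y\<^sup>2 then M t else 0)"
    proof (cases "M A * M t > y\<^sup>2")
      case True
      then show ?thesis using p iff by simp
    next
      case False
      have "D * (M A * M t) * ?p / l = (M A * M t) * ?p / y\<^sup>2" unfolding lD using D by simp
      also have "\<dots> \<le> (M A * M t) * (B / M A) / y\<^sup>2"
        using p M_pos[of A] M_pos[of t] by (intro divide_right_mono mult_left_mono) auto
      also have "\<dots> = B / y\<^sup>2 * M t" using M_pos[of A] by simp
      finally show ?thesis using False iff by simp
    qed
  qed
  also have "\<dots> = B * (\<Sum>A\<le>N. \<Sum>t\<le>A. if M A * M t > y\<^sup>2 then 1 / M A else 0)
      + B / y\<^sup>2 * (\<Sum>A\<le>N. \<Sum>t\<le>A. if M A * M t \<le> y\<^sup>2 then M t else 0)"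
    by (simp only: sum.distrib sum_distrib_left)
  also have "\<dots> \<le> B * (8 / y) + B / y\<^sup>2 * (8 * y)"
    using B_ge_2 by (intro add_mono mult_left_mono double_sum_large double_sum_small y) auto
  also have "\<dots> = 16 * B / y" using y by (simp add: power2_eq_square)
  finally show ?thesis .
qed

lemma conv_cong: "(\<And>y. y \<in> G \<Longrightarrow> g y = h y) \<Longrightarrow> conv n g x = conv n h x"
  unfolding conv_def by (intro Bochner_Integration.integral_cong) auto

lemma integrable_conv:
  assumes "cylindrical L g"
  shows "integrable (vilenkin m) (\<lambda>y. g y * fejer n x y)"
proof -
  obtain K where K: "cylindrical K (\<lambda>y. fejer n x y)" using cylindrical_fejer' by blast
  show ?thesis
    by (rule cylindrical_integrable[of "max L K"])
       (intro cylindrical_comp2[of _ _ _ "(*)"] cylindrical_mono[OF assms] cylindrical_mono[OF K]; simp)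
qed

lemma conv_add:
  assumes "cylindrical L g" "cylindrical L h"
  shows "conv n (\<lambda>y. g y + h y) x = conv n g x + conv n h x"
  unfolding conv_def distrib_right
  by (rule Bochner_Integration.integral_add[OF integrable_conv[OF assms(1)] integrable_conv[OF assms(2)]])

lemma conv_sum:
  assumes "\<And>i. i \<in> I \<Longrightarrow> cylindrical L (g i)"
  shows "conv n (\<lambda>y. \<Sum>i\<in>I. g i y) x = (\<Sum>i\<in>I. conv n (g i) x)"
  unfolding conv_def sum_distrib_right
  by (rule Bochner_Integration.integral_sum) (rule integrable_conv[OF assms])

text \<open>\<open>K\<close> depends on \<open>f\<close> and \<open>L\<close>; this is harmless
  because \<open>sum_prob_exceed_le\<close> is uniform in \<open>K\<close>. In the threshold
  \<open>2 * n\<close>, one \<open>n\<close> is for the bounded part and the other for the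
  atoms.\<close>

lemma prob_conv_gt_le:
  assumes f: "vmartingale m f" and \<alpha>: "\<alpha> > 0"
  obtains K where "prob {x\<in>G. \<exists>n. 30 * B^4 * \<alpha> * (2 * n) < norm (conv n (f L) x)} \<le>
    17 * B\<^sup>2 * (\<Sum>k<K. 2^k * prob {x\<in>G. exceed f (\<alpha> * 4^k) L x})"
proof -
  \<comment> \<open>This covers both \<open>12 * B^4\<close> from \<open>norm_conv_le\<close> and
    \<open>6 * B^3 * 5\<close> from the atoms, where \<open>5 = 4 + 1\<close> comes from the heights
    of \<open>g (Suc k)\<close> and \<open>g k\<close>.\<close>
  define C where "C = 30 * B^4"
  have C: "C > 0" using B_ge_2 by (simp add: C_def)
  obtain \<beta> where \<beta>: "\<And>x. x \<in> G \<Longrightarrow> good f \<beta> L x" using good_large[OF f] by blast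
  obtain K' where K': "\<beta> / \<alpha> < 4 ^ K'" using real_arch_pow[of 4] by auto
  \<comment> \<open>The \<open>Suc\<close> makes sure that \<open>k = 0\<close> occurs in the sum,
    which the estimate of the bad set uses.\<close>
  define K where "K = Suc K'"
  have "\<beta> < \<alpha> * 4^K'" using K' \<alpha> by (simp add: field_simps)
  also have "\<dots> \<le> \<alpha> * 4^K" using \<alpha> by (simp add: K_def)
  finally have goodK: "good f (\<alpha> * 4^K) L x" if "x \<in> G" for x
    using good_mono[OF \<beta>[OF that]] by simp
  define g where "g k = stopped f (\<alpha> * 4^k) L" for k
  define cs where "cs k = cells f (\<alpha> * 4^k) L" for k :: nat
  define atom where "atom k c = (\<lambda>y. (g (Suc k) y - g k y) * of_bool (y \<in> vinterval m (fst c) (snd c)))"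
    for k and c :: "nat \<times> (nat \<Rightarrow> nat)"
  have cylg: "cylindrical L (g k)" for k unfolding g_def by (rule cylindrical_stopped[OF f])
  have cylatom: "cylindrical L (atom k c)" if "c \<in> cs k" for k c
    unfolding atom_def using cellsD(1)[of "fst c" "snd c"] that unfolding cs_def
    by (intro cylindrical_comp2[of _ _ _ "\<lambda>a b. a * of_bool b"] cylindrical_comp2[of _ _ _ "(-)"] cylg cylindrical_vinterval) simp
  have finc: "finite (cs k)" for k unfolding cs_def by (rule finite_cells)
  have mono4: "\<alpha> * 4^k \<le> \<alpha> * 4^l" if "k \<le> l" for k l :: nat
    using \<alpha> that by (intro mult_left_mono power_increasing) auto

  \<comment> \<open>At the top height stopping never occurs, so \<open>g K\<close> is
    \<open>f L\<close>. Telescoping down to \<open>g 0\<close> leaves differences, each of which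
    vanishes off the cells of its lower height.\<close>
  have decomp: "f L y = g 0 y + (\<Sum>k<K. \<Sum>c\<in>cs k. atom k c y)" if y: "y \<in> G" for y
  proof -
    have "(\<Sum>c\<in>cs k. atom k c y) = g (Suc k) y - g k y" for k
    proof -
      have zero: "g (Suc k) y - g k y = 0" if "good f (\<alpha> * 4^k) L y"
        using stopped_eq[OF that] stopped_eq[OF good_mono[OF that mono4[of k "Suc k"]]] by (simp add: g_def)
      show ?thesis
        using sum_cells[of y f "\<alpha> * 4^k" L "g (Suc k) y - g k y", OF y zero]
        by (simp add: atom_def cs_def split_beta)
    qed
    then have "(\<Sum>k<K. \<Sum>c\<in>cs k. atom k c y) = g K y - g 0 y"
      using sum_lessThan_telescope[of "\<lambda>k. g k y" K] by simp
    then show ?thesis using stopped_eq[OF goodK[OF y]] by (simp add: g_def)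
  qed

  define D where "D k c = C * \<alpha> * 4^k / (M (fst c))\<^sup>2" for k and c :: "nat \<times> (nat \<Rightarrow> nat)"
  define S where "S x = (\<Sum>k<K. \<Sum>c\<in>cs k. \<Sum>A\<le>fst c. \<Sum>t\<le>A. D k c * (M A * M t) * of_bool (agree t A (snd c) x))" for x
  have Dpos: "D k c > 0" for k c unfolding D_def using C \<alpha> M_pos[of "fst c"] by simp

  \<comment> \<open>\<open>S\<close> does not depend on \<open>n\<close>, so one exceptional set
    serves all means at once.\<close>
  have conv_le: "norm (conv n (f L) x) \<le> C * \<alpha> * n + S x * n" if x: "x \<in> G" and good: "good f \<alpha> L x" for n x
  proof -
    have atom_le: "norm (conv n (atom k c) x) \<le>
        (\<Sum>A\<le>fst c. \<Sum>t\<le>A. D k c * (M A * M t) * of_bool (agree t A (snd c) x)) * n" if c: "c \<in> cs k" for k c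
    proof -
      obtain N z where ceq: "c = (N, z)" by (cases c)
      note cD = cellsD[OF c[unfolded cs_def ceq]]
      let ?W = "\<Sum>A\<le>N. \<Sum>t\<le>A. M A * M t * of_bool (agree t A z x)"
      have W: "?W \<ge> 0" by (intro sum_nonneg) auto
      have "norm (conv n (atom k c) x) \<le> 6 * B^3 * (5 * (\<alpha> * 4^k)) / (M N)\<^sup>2 * ?W * n"
      proof (rule norm_conv_atom_le[OF x cD(2) _ cylatom[OF c]])
        \<comment> \<open>A point good at height \<open>\<alpha>\<close> is good at all larger
          heights, hence lies in no cell.\<close>
        show "x \<notin> vinterval m N z"
          using not_good_in_cell[OF c[unfolded cs_def ceq], of x] good_mono[OF good, of "\<alpha> * 4^k"] mono4[of 0 k] by auto
        show "norm (atom k c y) \<le> 5 * (\<alpha> * 4^k)" if y: "y \<in> G" for y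
        proof -
          have "norm (atom k c y) \<le> norm (g (Suc k) y - g k y)" by (simp add: atom_def norm_mult)
          also have "\<dots> \<le> norm (g (Suc k) y) + norm (g k y)" by (rule norm_triangle_ineq4)
          also have "\<dots> \<le> \<alpha> * 4^Suc k + \<alpha> * 4^k"
            unfolding g_def using \<alpha> by (intro add_mono norm_stopped_le[OF y]) auto
          finally show ?thesis by simp
        qed
        show "atom k c y = 0" if "y \<notin> vinterval m N z" for y using that by (simp add: atom_def ceq)
        assume N: "N > 0"
        \<comment> \<open>Before rank \<open>N\<close> of a cell of height index \<open>k\<close>,
          neither \<open>g k\<close> nor \<open>g (Suc k)\<close> has stopped, so both have the
          integral of \<open>f N\<close> over the cell.\<close>
        have good': "good f (\<alpha> * 4^l) i z" if "i < N" "k \<le> l" for i l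
          using cD(3) that good_mono[OF _ mono4[OF that(2)]] by (auto simp: stops_def)
        have int: "integrable (vilenkin m) (\<lambda>y. g l y * of_bool (y \<in> vinterval m N z))" for l
          by (rule cylindrical_integrable[of L])
             (intro cylindrical_comp2[of _ _ _ "\<lambda>a b. a * of_bool b"] cylg cylindrical_vinterval cD(1))
        have "(\<integral>y. g l y * of_bool (y \<in> vinterval m N z) \<partial>vilenkin m) = (\<integral>y. f N y * of_bool (y \<in> vinterval m N z) \<partial>vilenkin m)"
          if "k \<le> l" for l
          unfolding g_def by (rule integral_stopped_vinterval[OF f cD(2) N cD(1)]) (rule good'[OF _ that])
        from this[of k] this[of "Suc k"] show "(\<integral>y. atom k c y \<partial>vilenkin m) = 0"
          unfolding atom_def ceq fst_conv snd_conv left_diff_distrib Bochner_Integration.integral_diff[OF int int] by simp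
      qed
      also have "6 * B^3 * (5 * (\<alpha> * 4^k)) / (M N)\<^sup>2 * ?W * n \<le> D k c * ?W * n"
      proof (intro mult_right_mono W)
        have "30 * B^3 \<le> C" unfolding C_def using B_ge_2 by (intro mult_left_mono power_increasing) auto
        from mult_right_mono[OF this, of "\<alpha> * 4^k / (M N)\<^sup>2"] \<alpha>
        show "6 * B^3 * (5 * (\<alpha> * 4^k)) / (M N)\<^sup>2 \<le> D k c" by (simp add: D_def ceq mult_ac)
      qed simp
      finally show ?thesis by (simp add: ceq sum_distrib_left mult.assoc)
    qed
    have "conv n (f L) x = conv n (\<lambda>y. g 0 y + (\<Sum>k<K. \<Sum>c\<in>cs k. atom k c y)) x"
      by (rule conv_cong) (rule decomp)
    also have "\<dots> = conv n (g 0) x + (\<Sum>k<K. \<Sum>c\<in>cs k. conv n (atom k c) x)"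
    proof -
      have cyl: "cylindrical L (\<lambda>y. \<Sum>c\<in>cs k. atom k c y)" for k
        by (rule cylindrical_sum[OF cylatom])
      have "conv n (\<lambda>y. g 0 y + (\<Sum>k<K. \<Sum>c\<in>cs k. atom k c y)) x =
          conv n (g 0) x + (\<Sum>k<K. conv n (\<lambda>y. \<Sum>c\<in>cs k. atom k c y) x)"
        by (simp only: conv_add[OF cylg cylindrical_sum[OF cyl]] conv_sum[OF cyl])
      moreover have "conv n (\<lambda>y. \<Sum>c\<in>cs k. atom k c y) x = (\<Sum>c\<in>cs k. conv n (atom k c) x)" for k
        by (rule conv_sum) (rule cylatom)
      ultimately show ?thesis by (simp only:)
    qed
    finally have "norm (conv n (f L) x) \<le> norm (conv n (g 0) x) + norm (\<Sum>k<K. \<Sum>c\<in>cs k. conv n (atom k c) x)"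
      by (simp only: norm_triangle_ineq)
    also have "norm (conv n (g 0) x) \<le> 12 * B^4 * \<alpha> * n"
      using \<alpha> norm_stopped_le[of _ "\<alpha> * 4^0"] by (intro norm_conv_le[OF x cylg]) (auto simp: g_def)
    also have "\<dots> \<le> C * \<alpha> * n"
      unfolding C_def using \<alpha> B_ge_2 by (intro mult_right_mono) auto
    also have "norm (\<Sum>k<K. \<Sum>c\<in>cs k. conv n (atom k c) x) \<le>
        (\<Sum>k<K. \<Sum>c\<in>cs k. (\<Sum>A\<le>fst c. \<Sum>t\<le>A. D k c * (M A * M t) * of_bool (agree t A (snd c) x)) * n)"
      by (intro sum_norm_le atom_le)
    also have "\<dots> = S x * n" unfolding S_def sum_distrib_right ..
    finally show ?thesis by simp
  qed

  let ?bad = "{x\<in>G. \<not> good f \<alpha> L x}" and ?tail = "{x\<in>G. C * \<alpha> < S x}"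
  define J where "J = (SIGMA k:{..<K}. SIGMA c:cs k. SIGMA A:{..fst c}. {..A})"
  have finJ: "finite J" unfolding J_def using finc by (intro finite_SigmaI) auto
  let ?Q = "\<lambda>i x. agree (snd (snd (snd i))) (fst (snd (snd i))) (snd (fst (snd i))) x"
  let ?c = "\<lambda>i. D (fst i) (fst (snd i)) * (M (fst (snd (snd i))) * M (snd (snd (snd i))))"
  have S_eq: "S x = (\<Sum>i\<in>J. ?c i * of_bool (?Q i x))" for x
    unfolding S_def J_def by (rule sum4_Sigma) (auto simp: finc)
  have "prob ?tail \<le> (\<Sum>i\<in>J. if C * \<alpha> < ?c i then prob {x\<in>G. ?Q i x} else ?c i * prob {x\<in>G. ?Q i x} / (C * \<alpha>))"
    unfolding S_eq using C \<alpha> Dpos M_pos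
    by (intro prob_sum_gt_le finJ sets_agree) (auto intro!: mult_nonneg_nonneg simp: less_imp_le)
  also have "\<dots> = (\<Sum>k<K. \<Sum>c\<in>cs k. \<Sum>A\<le>fst c. \<Sum>t\<le>A. if C * \<alpha> < D k c * (M A * M t) then prob {x\<in>G. agree t A (snd c) x}
      else D k c * (M A * M t) * prob {x\<in>G. agree t A (snd c) x} / (C * \<alpha>))"
    unfolding J_def by (rule sum4_Sigma[symmetric]) (auto simp: finc)
  \<comment> \<open>The choice \<open>y = M (fst c) / 2^k\<close> solves
    \<open>C * \<alpha> = D k c * y\<^sup>2\<close>; a cell thus costs a constant times
    \<open>2^k\<close> times its measure.\<close>
  also have "\<dots> \<le> (\<Sum>k<K. \<Sum>c\<in>cs k. 16 * B / (M (fst c) / 2^k))"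
  proof (intro sum_mono cell_tail_sum)
    fix k c assume "c \<in> cs k"
    then show "snd c \<in> G" using cellsD(2)[of "fst c" "snd c"] by (simp add: cs_def)
    have "((2::real)^k)\<^sup>2 = 4^k" by (simp add: power2_eq_square flip: power_mult_distrib)
    then show "C * \<alpha> = D k c * (M (fst c) / 2^k)\<^sup>2"
      using M_pos[of "fst c"] by (simp add: D_def power_divide)
    show "0 < M (fst c) / 2^k" using M_pos[of "fst c"] by simp
  qed (use C \<alpha> Dpos in simp_all)
  also have "\<dots> = (\<Sum>k<K. 16 * B * 2^k * (\<Sum>(N, z)\<in>cs k. 1 / M N))"
    by (simp add: sum_distrib_left split_beta)
  also have "\<dots> \<le> (\<Sum>k<K. 16 * B * 2^k * (B * prob {x\<in>G. exceed f (\<alpha> * 4^k) L x}))"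
    unfolding cs_def using B_ge_2 by (intro sum_mono mult_left_mono sum_cells_le[OF f]) auto
  also have "\<dots> = 16 * B\<^sup>2 * (\<Sum>k<K. 2^k * prob {x\<in>G. exceed f (\<alpha> * 4^k) L x})"
    by (simp add: sum_distrib_left power2_eq_square mult_ac)
  finally have tail: "prob ?tail \<le> 16 * B\<^sup>2 * (\<Sum>k<K. 2^k * prob {x\<in>G. exceed f (\<alpha> * 4^k) L x})" .
  have "prob ?bad \<le> B * prob {x\<in>G. exceed f \<alpha> L x}"
    unfolding prob_not_good by (rule sum_cells_le[OF f])
  also have "\<dots> \<le> B\<^sup>2 * prob {x\<in>G. exceed f \<alpha> L x}"
    using B_ge_2 self_le_power[of B 2] by (intro mult_right_mono) auto
  also have "prob {x\<in>G. exceed f \<alpha> L x} = 2^0 * prob {x\<in>G. exceed f (\<alpha> * 4^0) L x}" by simp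
  also have "\<dots> \<le> (\<Sum>k<K. 2^k * prob {x\<in>G. exceed f (\<alpha> * 4^k) L x})"
    by (rule member_le_sum) (auto simp: K_def)
  finally have bad: "prob ?bad \<le> B\<^sup>2 * (\<Sum>k<K. 2^k * prob {x\<in>G. exceed f (\<alpha> * 4^k) L x})"
    using B_ge_2 by (simp add: mult_left_mono)
  have sets_bad: "?bad \<in> sets (vilenkin m)"
    by (rule cylindrical_sets[of L]) (rule cylindrical_comp[OF cylindrical_good])
  have sets_tail: "?tail \<in> sets (vilenkin m)"
  proof -
    have "(\<lambda>x. of_bool (?Q i x) :: real) \<in> borel_measurable (vilenkin m)" for i :: "nat \<times> (nat \<times> (nat \<Rightarrow> nat)) \<times> nat \<times> nat"
      by (rule borel_measurable_integrable) (rule integrable_of_bool_agree)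
    then have "S \<in> borel_measurable (vilenkin m)" unfolding S_eq[abs_def] by (intro borel_measurable_sum borel_measurable_times borel_measurable_const)
    then show ?thesis by measurable
  qed
  have "{x\<in>G. \<exists>n. 30 * B^4 * \<alpha> * (2 * n) < norm (conv n (f L) x)} \<subseteq> ?bad \<union> ?tail"
  proof
    fix x assume "x \<in> {x\<in>G. \<exists>n. 30 * B^4 * \<alpha> * (2 * n) < norm (conv n (f L) x)}"
    then obtain n where x: "x \<in> G" and n: "C * \<alpha> * (2 * n) < norm (conv n (f L) x)" by (auto simp: C_def)
    show "x \<in> ?bad \<union> ?tail"
    proof (cases "good f \<alpha> L x")
      case True
      have "C * \<alpha> * n < S x * n" using conv_le[OF x True, of n] n by simp
      then show ?thesis using x by (simp add: mult_less_cancel_right)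
    qed (use x in simp)
  qed
  then have "prob {x\<in>G. \<exists>n. 30 * B^4 * \<alpha> * (2 * n) < norm (conv n (f L) x)} \<le> prob (?bad \<union> ?tail)"
    using sets_bad sets_tail by (intro finite_measure_mono) auto
  also have "\<dots> \<le> prob ?bad + prob ?tail" using sets_bad sets_tail by (rule measure_Un_le)
  also have "\<dots> \<le> 17 * B\<^sup>2 * (\<Sum>k<K. 2^k * prob {x\<in>G. exceed f (\<alpha> * 4^k) L x})"
    using bad tail by (simp add: algebra_simps)
  finally show ?thesis by (rule that)
qed


text \<open>After exchanging sum and integral, \<open>sum_powers_below_le\<close> applies pointwise.
  The bound is uniform in \<open>K\<close> and \<open>L\<close>.\<close>

lemma sum_prob_exceed_le:
  assumes f: "vmartingale m f" and \<alpha>: "\<alpha> > 0"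
    and fin: "(\<integral>\<^sup>+x. ennreal_powr (maximal_function f x) (1/2) \<partial>vilenkin m) \<le> ennreal I" and I: "I \<ge> 0"
  shows "(\<Sum>k<K. 2^k * prob {x\<in>G. exceed f (\<alpha> * 4^k) L x}) \<le> 2 * I / sqrt \<alpha>"
proof -
  \<comment> \<open>A finite maximum is real valued and cylindrical, whereas
    \<open>maximal_function\<close> may be infinite.\<close>
  define u where "u x = Max ((\<lambda>n. norm (f n x)) ` {..Suc L})" for x
  have exceed_iff: "exceed f \<beta> L x \<longleftrightarrow> \<beta> < u x" for \<beta> x
    unfolding exceed_def u_def by (subst Max_gr_iff) auto
  have u_nonneg: "u x \<ge> 0" for x
    unfolding u_def by (rule order_trans[OF norm_ge_zero[of "f 0 x"]]) (intro Max_ge, auto)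
  have cylf: "cylindrical (Suc L) (f n)" if "n \<le> Suc L" for n
    using that by (rule cylindrical_mono[OF vmartingale_cylindrical[OF f]])
  have cylu: "cylindrical (Suc L) u"
  proof (rule cylindricalI)
    fix x y assume "x \<in> G" "y \<in> G" "\<And>j. j < Suc L \<Longrightarrow> x j = y j"
    then have "f n x = f n y" if "n \<le> Suc L" for n by (rule cylindrical_eq[OF cylf[OF that]])
    then show "u x = u y" unfolding u_def by (intro arg_cong[where f=Max] image_cong) auto
  qed
  have int: "integrable (vilenkin m) (\<lambda>x. sqrt (u x))"
    by (rule cylindrical_integrable) (rule cylindrical_comp[OF cylu])
  have "ennreal (\<integral>x. sqrt (u x) \<partial>vilenkin m) = (\<integral>\<^sup>+x. ennreal (sqrt (u x)) \<partial>vilenkin m)"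
    using u_nonneg by (intro nn_integral_eq_integral[symmetric] int) auto
  also have "\<dots> \<le> (\<integral>\<^sup>+x. ennreal_powr (maximal_function f x) (1/2) \<partial>vilenkin m)"
  proof (rule nn_integral_mono)
    fix x
    have "u x \<in> (\<lambda>n. norm (f n x)) ` {..Suc L}" unfolding u_def by (rule Max_in) auto
    then obtain n where n: "u x = norm (f n x)" by blast
    have u_le: "ennreal (u x) \<le> maximal_function f x"
      unfolding maximal_function_def n by (rule SUP_upper) simp
    show "ennreal (sqrt (u x)) \<le> ennreal_powr (maximal_function f x) (1/2)"
    proof (cases "maximal_function f x = \<top>")
      case False
      then obtain r where r: "maximal_function f x = ennreal r" "r \<ge> 0"
        by (cases "maximal_function f x") auto
      have "u x \<le> r" using u_le r by simp
      then have "sqrt (u x) \<le> r powr (1/2)" using r by (simp add: powr_half_sqrt)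
      then show ?thesis using r by (simp add: ennreal_powr_def ennreal_leI)
    qed (simp add: ennreal_powr_def)
  qed
  also note fin
  finally have u_int: "(\<integral>x. sqrt (u x) \<partial>vilenkin m) \<le> I" using I by simp
  have int1: "integrable (vilenkin m) (\<lambda>x. of_bool (\<alpha> * 4^k < u x) :: real)" for k
    by (rule cylindrical_integrable) (rule cylindrical_comp[OF cylu])
  have "(\<Sum>k<K. 2^k * prob {x\<in>G. exceed f (\<alpha> * 4^k) L x}) =
      (\<integral>x. 1 * (\<Sum>k<K. 2^k * of_bool (\<alpha> * 4^k < u x)) \<partial>vilenkin m)"
    unfolding exceed_iff by (subst integral_sum_of_bool) (simp_all add: int1)
  also have "\<dots> \<le> (\<integral>x. 2 / sqrt \<alpha> * sqrt (u x) \<partial>vilenkin m)"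
  proof (rule integral_mono)
    show "integrable (vilenkin m) (\<lambda>x. 1 * (\<Sum>k<K. 2^k * of_bool (\<alpha> * 4^k < u x)) :: real)"
      using int1 by auto
    show "integrable (vilenkin m) (\<lambda>x. 2 / sqrt \<alpha> * sqrt (u x))" using int by auto
    fix x
    show "1 * (\<Sum>k<K. 2^k * of_bool (\<alpha> * 4^k < u x)) \<le> 2 / sqrt \<alpha> * sqrt (u x)"
      using sum_powers_below_le[OF \<alpha> u_nonneg[of x], of K] by (simp add: real_sqrt_divide)
  qed
  also have "\<dots> = 2 / sqrt \<alpha> * (\<integral>x. sqrt (u x) \<partial>vilenkin m)" by simp
  also have "\<dots> \<le> 2 / sqrt \<alpha> * I" using u_int \<alpha> by (intro mult_left_mono) auto
  finally show ?thesis by simp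
qed

section \<open>The maximal operator of Riesz means\<close>

lemma cylindrical_vpartial_sum:
  assumes "n \<le> vbase m L"
  shows "cylindrical L (vpartial_sum m f n)"
  unfolding vpartial_sum_def[abs_def] using assms
  by (intro cylindrical_sum cylindrical_comp[of L _ "\<lambda>u. c * u" for c] cylindrical_vpsi) auto

lemma riesz_maximal_measurable: "riesz_maximal m f \<in> borel_measurable (vilenkin m)"
  unfolding riesz_maximal_def[abs_def]
proof (rule borel_measurable_SUP)
  fix n :: nat
  have "cylindrical n (riesz_mean m f n)"
    unfolding riesz_mean_def[abs_def]
  proof (intro cylindrical_comp[of n _ "\<lambda>u. c * u" for c] cylindrical_sum cylindrical_comp[of n _ "\<lambda>u. u / c" for c] cylindrical_vpartial_sum)
    fix k assume "k \<in> {1..n}"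
    then show "k \<le> vbase m n" using less_vbase[of n] by auto
  qed
  then show "(\<lambda>x. ennreal (norm (riesz_mean m f n x))) \<in> borel_measurable (vilenkin m)"
    by (intro cylindrical_measurable[of n] cylindrical_comp[of n _ "\<lambda>u. ennreal (norm u)"])
qed simp

lemma prob_riesz_maximal_le:
  assumes f: "vmartingale m f" and t: "t > 0"
    and fin: "(\<integral>\<^sup>+x. ennreal_powr (maximal_function f x) (1/2) \<partial>vilenkin m) \<le> ennreal I" and I: "I \<ge> 0"
  shows "prob {x\<in>G. ennreal t < riesz_maximal m f x} \<le> 34 * B\<^sup>2 * I * sqrt (60 * B^4 / t)"
proof -
  \<comment> \<open>Chosen so that the threshold of \<open>prob_conv_gt_le\<close> becomes
    \<open>t * n\<close>.\<close>
  define \<alpha> where "\<alpha> = t / (60 * B^4)"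
  have B4: "B^4 > 0" using B_ge_2 by simp
  have \<alpha>: "\<alpha> > 0" using t B4 by (simp add: \<alpha>_def)
  have \<alpha>t: "30 * B^4 * \<alpha> * (2 * r) = t * r" for r using B4 by (simp add: \<alpha>_def)
  let ?K = "34 * B\<^sup>2 * I * sqrt (60 * B^4 / t)"
  let ?F = "\<lambda>n x. \<Sum>j=1..n. vpartial_sum m f j x"
  \<comment> \<open>Only indices handled by \<open>f L\<close> enter \<open>U L\<close>; since
    \<open>k < vbase m k\<close>, every index is reached for some \<open>L\<close>.\<close>
  define U where "U L = {x\<in>G. \<exists>n. n \<le> vbase m L \<and> t * n < norm (?F n x)}" for L
  have sets_U: "U L \<in> sets (vilenkin m)" for L
    unfolding U_def
  proof (rule cylindrical_sets[of L], rule cylindricalI)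
    fix x y assume xy: "x \<in> G" "y \<in> G" "\<And>j. j < L \<Longrightarrow> x j = y j"
    have "?F n x = ?F n y" if "n \<le> vbase m L" for n
      using that by (intro sum.cong refl cylindrical_eq[OF cylindrical_vpartial_sum xy]) auto
    then show "(\<exists>n. n \<le> vbase m L \<and> t * n < norm (?F n x)) = (\<exists>n. n \<le> vbase m L \<and> t * n < norm (?F n y))"
      by (intro ex_cong1 conj_cong) auto
  qed
  have prob_U: "prob (U L) \<le> ?K" for L
  proof -
    obtain K where K: "prob {x\<in>G. \<exists>n. 30 * B^4 * \<alpha> * (2 * n) < norm (conv n (f L) x)} \<le>
        17 * B\<^sup>2 * (\<Sum>k<K. 2^k * prob {x\<in>G. exceed f (\<alpha> * 4^k) L x})"
      using prob_conv_gt_le[OF f \<alpha>] by blast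
    have meas: "{x\<in>G. \<exists>n. t * n < norm (conv n (f L) x)} \<in> sets (vilenkin m)"
    proof -
      have [measurable]: "conv n (f L) \<in> borel_measurable (vilenkin m)" for n
      proof -
        have "cylindrical n (conv n (f L))"
        proof (rule cylindricalI)
          fix x y assume xy: "x \<in> G" "y \<in> G" "\<And>j. j < n \<Longrightarrow> x j = y j"
          have "fejer n x w = fejer n y w" for w
            unfolding fejer_def dirichlet_def
          proof (intro sum.cong refl arg_cong2[where f="(*)"] cylindrical_eq[OF cylindrical_vpsi xy])
            fix k i assume "k \<in> {1..n}" "i \<in> {..<k}"
            then show "i < vbase m n" using less_vbase[of n] by auto
          qed
          then show "conv n (f L) x = conv n (f L) y" unfolding conv_def by simp
        qed
        then show ?thesis by (rule cylindrical_measurable)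
      qed
      show ?thesis by measurable
    qed
    have "U L \<subseteq> {x\<in>G. \<exists>n. t * n < norm (conv n (f L) x)}"
      using sum_vpartial_sum[OF f] unfolding U_def by auto
    then have "prob (U L) \<le> prob {x\<in>G. \<exists>n. t * n < norm (conv n (f L) x)}"
      using meas by (rule finite_measure_mono)
    also have "\<dots> \<le> 17 * B\<^sup>2 * (\<Sum>k<K. 2^k * prob {x\<in>G. exceed f (\<alpha> * 4^k) L x})"
      using K unfolding \<alpha>t .
    also have "\<dots> \<le> 17 * B\<^sup>2 * (2 * I / sqrt \<alpha>)"
      by (intro mult_left_mono sum_prob_exceed_le[OF f \<alpha> fin I]) simp
    also have "\<dots> = ?K"
      using t B4 by (simp add: \<alpha>_def real_sqrt_divide)
    finally show ?thesis .
  qed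
  have inc: "incseq U"
    unfolding U_def
  proof (intro monoI Collect_mono conj_mono imp_refl ex_mono allI impI)
    fix i j n assume "i \<le> j" "n \<le> vbase m i"
    then show "n \<le> vbase m j" using vbase_mono[of i j] by simp
  qed
  have "{x\<in>G. ennreal t < riesz_maximal m f x} \<subseteq> (\<Union>L. U L)"
  proof (rule subsetI, rule ccontr)
    fix x assume x: "x \<in> {x\<in>G. ennreal t < riesz_maximal m f x}" and notin: "x \<notin> (\<Union>L. U L)"
    have F: "norm (?F k x) \<le> t * k" for k
    proof (rule ccontr)
      assume "\<not> norm (?F k x) \<le> t * k"
      then have "x \<in> U k" using x less_vbase[of k] unfolding U_def by (auto intro: less_imp_le)
      then show False using notin by blast
    qed
    have "riesz_maximal m f x \<le> ennreal t"
      unfolding riesz_maximal_def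
    proof (intro SUP_least ennreal_leI)
      fix n :: nat assume "n \<in> {1..}"
      then show "norm (riesz_mean m f n x) \<le> t"
        using t F by (intro norm_riesz_mean_le) auto
    qed
    then show False using x leD by blast
  qed
  then have "prob {x\<in>G. ennreal t < riesz_maximal m f x} \<le> prob (\<Union>L. U L)"
    using sets_U by (intro finite_measure_mono) auto
  \<comment> \<open>The bound for \<open>U L\<close> is independent of \<open>L\<close> and passes
    to the limit along the increasing sets.\<close>
  also have "\<dots> \<le> ?K"
    using finite_Lim_measure_incseq[OF _ inc] sets_U prob_U
    by (intro LIMSEQ_le_const2[of "\<lambda>L. prob (U L)"]) auto
  finally show ?thesis .
qed

text \<open>For exponent \<open>1/2\<close> both quasi-norms square: the decay
  \<open>1 / sqrt t\<close> of the probability becomes \<open>1 / t\<close>, cancelling the factor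
  \<open>t\<close>, and \<open>I\<close> becomes the Hardy norm \<open>I\<^sup>2\<close>.\<close>

lemma weak_Lp_norm_riesz_maximal_le:
  assumes f: "f \<in> Hp m (1/2)"
  shows "weak_Lp_norm (vilenkin m) (1/2) (riesz_maximal m f) \<le> ennreal ((34 * B\<^sup>2)\<^sup>2 * (60 * B^4)) * Hp_norm m (1/2) f"
proof -
  let ?c = "(34 * B\<^sup>2)\<^sup>2 * (60 * B^4)"
  let ?I = "\<integral>\<^sup>+x. ennreal_powr (maximal_function f x) (1/2) \<partial>vilenkin m"
  have mart: "vmartingale m f" and "Hp_norm m (1/2) f < \<infinity>" using f by (auto simp: Hp_def)
  then have "?I \<noteq> \<top>" by (auto simp: Hp_norm_def Lp_norm_def ennreal_powr_def)
  then obtain I where I: "?I = ennreal I" "I \<ge> 0" by (cases ?I) auto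
  have Hp: "Hp_norm m (1/2) f = ennreal (I\<^sup>2)"
    using I by (simp add: Hp_norm_def Lp_norm_def ennreal_powr_def powr_numeral)
  show ?thesis
    unfolding weak_Lp_norm_def
  proof (rule SUP_least)
    fix t :: real assume "t \<in> {0<..}"
    then have t: "t > 0" by simp
    let ?p = "prob {x\<in>G. ennreal t < riesz_maximal m f x}"
    have "?p\<^sup>2 \<le> (34 * B\<^sup>2 * I * sqrt (60 * B^4 / t))\<^sup>2"
      using prob_riesz_maximal_le[OF mart t _ I(2)] I by (intro power_mono) auto
    also have "\<dots> = (34 * B\<^sup>2)\<^sup>2 * I\<^sup>2 * (60 * B^4 / t)"
      using t B_ge_2 by (simp only: power_mult_distrib) simp
    finally have "t * ?p\<^sup>2 \<le> t * ((34 * B\<^sup>2)\<^sup>2 * I\<^sup>2 * (60 * B^4 / t))"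
      using t by (intro mult_left_mono) auto
    also have "\<dots> = ?c * I\<^sup>2" using t by simp
    finally have "ennreal (t * ?p\<^sup>2) \<le> ennreal (?c * I\<^sup>2)" by (rule ennreal_leI)
    then show "ennreal t * ennreal_powr (emeasure (vilenkin m) {x\<in>G. ennreal t < riesz_maximal m f x}) (1 / (1/2))
        \<le> ennreal ?c * Hp_norm m (1/2) f"
      using t B_ge_2 unfolding Hp emeasure_eq_measure
      by (simp add: ennreal_powr_def powr_numeral ennreal_mult)
  qed
qed

end

theorem theorem1:
  fixes m :: "nat \<Rightarrow> nat"
  assumes "\<And>k. m k \<ge> 2"
    and "bdd_above (range m)"
  shows "\<exists>c::real. c \<ge> 0 \<and>
           (\<forall>f \<in> Hp m (1/2).
              riesz_maximal m f \<in> weak_Lp (vilenkin m) (1/2) \<and>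
              weak_Lp_norm (vilenkin m) (1/2) (riesz_maximal m f) \<le> ennreal c * Hp_norm m (1/2) f)"
proof -
  obtain b where b: "\<And>k. m k \<le> b" using assms(2) by (auto simp: bdd_above_def)
  interpret bounded_vilenkin m "real b"
    using assms(1) b by unfold_locales auto
  let ?c = "(34 * (real b)\<^sup>2)\<^sup>2 * (60 * real b^4)"
  show ?thesis
  proof (intro exI[of _ ?c] conjI ballI)
    fix f assume f: "f \<in> Hp m (1/2)"
    show le: "weak_Lp_norm (vilenkin m) (1/2) (riesz_maximal m f) \<le> ennreal ?c * Hp_norm m (1/2) f"
      by (rule weak_Lp_norm_riesz_maximal_le[OF f])
    also have "\<dots> < \<infinity>" using f by (simp add: Hp_def ennreal_mult_less_top)
    finally show "riesz_maximal m f \<in> weak_Lp (vilenkin m) (1/2)"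
      using riesz_maximal_measurable by (simp add: weak_Lp_def)
  qed simp
qed

end
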